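(* Let $T$ be an algebraic torus over $\mathbb{C}$, let $\mathbb{T}=T\times\mathbb{G}_m^{\mathrm{rot}}$, and let $A$ be a commutative Noetherian $\mathbb{C}$-algebra with an algebraic $\mathbb{T}$-action such that $A=\bigoplus_{\lambda\in X^*(T),\,k\ge 0}A_{\lambda+k\varpi_r}$ is non-negatively graded with respect to $\mathbb{G}_m^{\mathrm{rot}}$, with $A^{\mathbb{G}_m^{\mathrm{rot}}}=\mathbb{C}$. Let $\mathfrak{m}_A=\bigoplus_{\lambda\in X^*(T),\,k>0}A_{\lambda+k\varpi_r}$ and let $I^T(A)\subset A$ be the ideal generated by the nontrivial $T$-weight spaces of $A$. Then any $\mathbb{T}$-homogeneous basis $\{\overline{x}_{1},\dots,\overline{x}_{n}\}$ of $(\mathfrak{m}_A/\mathfrak{m}_A^2)^{\neq 0}$, with $\overline{x}_i$ of weight $\lambda_i+j_i\varpi_r$, may be lifted to a minimal generating set $\{x_1,\dots,x_n\}$ of $I^T(A)$ with each $x_i$ homogeneous of weight $\lambda_i+j_i\varpi_r$. In particular, the minimal number of generators of $I^T(A)$ is $\dim_{\mathbb{C}}(\mathfrak{m}_A/\mathfrak{m}_A^2)^{\neq 0}$.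
   Context: $\mathbb{G}_m^{\mathrm{rot}}$ is a copy of $\mathbb{G}_m$ with standard character $\varpi_r$; characters of $\mathbb{T}$ are written $\lambda+k\varpi_r$ with $\lambda\in X^*(T)$, $k\in\mathbb{Z}$, and $A_{\lambda+k\varpi_r}$ is the corresponding weight space. For a $\mathbb{T}$-representation $V$, $V^{\neq 0}$ denotes the direct sum of the $T$-weight spaces of $V$ with nontrivial $T$-weight. "Homogeneous" means homogeneous for the $\mathbb{T}$-action. When $X=\mathrm{Spec}(A)$ and $0\in X$ is the point defined by $\mathfrak{m}_A$, one has $\mathfrak{m}_A/\mathfrak{m}_A^2=T_0^*X$ and $I^T(A)$ (also written $I^T(X)$) is the ideal of the $T$-fixed subscheme $X^T$. *)

theory Defs
  imports Complex_Main "HOL-Algebra.Algebra" "HOL-Algebra.Algebraic_Closure_Type"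
begin

section \<open>Algebraic tori over the complex numbers\<close>

text \<open>
  An affine algebraic group over the complex numbers is given by its group of complex points
  together with its coordinate ring, viewed as a set of functions on the points.  Regular functions
  are normalised to be extensional on the carrier, so that they (and in particular characters)
  are equal iff they agree on all points.
\<close>

record 'g affine_group = "'g monoid" +
  regular :: "('g \<Rightarrow> complex) set"

definition Gm :: "complex affine_group" where
  "Gm = \<lparr>carrier = - {0}, monoid.mult = (*), one = 1,
         regular = {\<lambda>z\<in>- {0}. \<Sum>k\<in>K. c k * z powi k | (K :: int set) c. finite K}\<rparr>"

definition Gm_power :: "nat \<Rightarrow> (nat \<Rightarrow> complex) affine_group" where
  "Gm_power r = monoid.extend (product_group {..<r} (\<lambda>_. Gm))
     (affine_group.fields
       {\<lambda>t\<in>(\<Pi>\<^sub>E i\<in>{..<r}. - {0}). \<Sum>e\<in>E. c e * (\<Prod>i<r. t i powi e i)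
         | (E :: (nat \<Rightarrow> int) set) c. finite E})"

definition affine_group_iso ::
  "'g affine_group \<Rightarrow> 'h affine_group \<Rightarrow> ('g \<Rightarrow> 'h) \<Rightarrow> bool" where
  "affine_group_iso G H \<phi> \<longleftrightarrow> \<phi> \<in> iso G H \<and>
     regular G = (\<lambda>f. \<lambda>g\<in>carrier G. f (\<phi> g)) ` regular H"

definition algebraic_torus :: "'t affine_group \<Rightarrow> bool" where
  "algebraic_torus T \<longleftrightarrow> group T \<and> (\<exists>r \<phi>. affine_group_iso T (Gm_power r) \<phi>)"

definition affine_prod ::
  "'g affine_group \<Rightarrow> 'h affine_group \<Rightarrow> ('g \<times> 'h) affine_group" where
  "affine_prod G H = monoid.extend (G \<times>\<times> H)
     (affine_group.fields
       {\<lambda>(g, h)\<in>carrier G \<times> carrier H. \<Sum>i<m. u i g * v i h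
         | (m :: nat) u v. (\<forall>i<m. u i \<in> regular G \<and> v i \<in> regular H)})"

definition characters :: "'g affine_group \<Rightarrow> ('g \<Rightarrow> complex) set" where
  "characters G = regular G \<inter> hom G Gm"

definition trivial_char :: "'g affine_group \<Rightarrow> 'g \<Rightarrow> complex" where
  "trivial_char G = (\<lambda>g\<in>carrier G. 1)"

text \<open>The character \<open>\<lambda> + k\<varpi>\<^sub>r\<close> of \<open>T \<times> \<bbbG>\<^sub>m\<close>, written multiplicatively.\<close>

definition char_plus :: "('t \<Rightarrow> complex) \<Rightarrow> int \<Rightarrow> 't \<times> complex \<Rightarrow> complex" where
  "char_plus \<chi> k = (\<lambda>(t, z). \<chi> t * z powi k)"


section \<open>Linear algebra inside a complex module record\<close>

text \<open>The sum (inside \<open>M\<close>) of a family of subspaces, and the predicate that \<open>M\<close> is their internal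
  direct sum.\<close>

definition subspace_sum :: "(complex, 'a) module \<Rightarrow> 'i set \<Rightarrow> ('i \<Rightarrow> 'a set) \<Rightarrow> 'a set" where
  "subspace_sum M I V = {finsum M f J | f J. finite J \<and> J \<subseteq> I \<and> f \<in> (\<Pi> i\<in>J. V i)}"

definition is_direct_sum :: "(complex, 'a) module \<Rightarrow> 'i set \<Rightarrow> ('i \<Rightarrow> 'a set) \<Rightarrow> bool" where
  "is_direct_sum M I V \<longleftrightarrow> carrier M = subspace_sum M I V \<and>
     (\<forall>J f. finite J \<and> J \<subseteq> I \<and> f \<in> (\<Pi> i\<in>J. V i) \<and> finsum M f J = \<zero>\<^bsub>M\<^esub>
        \<longrightarrow> (\<forall>i\<in>J. f i = \<zero>\<^bsub>M\<^esub>))"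

text \<open>The family \<open>(v i)\<close>, \<open>i \<in> I\<close>, with \<open>I\<close> finite, is a basis of the subspace \<open>W\<close> of \<open>M\<close>.\<close>

definition is_basis :: "(complex, 'a) module \<Rightarrow> 'a set \<Rightarrow> 'i set \<Rightarrow> ('i \<Rightarrow> 'a) \<Rightarrow> bool" where
  "is_basis M W I v \<longleftrightarrow> finite I \<and> v \<in> I \<rightarrow> W \<and>
     (\<forall>c. (\<Oplus>\<^bsub>M\<^esub>i\<in>I. c i \<odot>\<^bsub>M\<^esub> v i) = \<zero>\<^bsub>M\<^esub> \<longrightarrow> (\<forall>i\<in>I. c i = 0)) \<and>
     W = {\<Oplus>\<^bsub>M\<^esub>i\<in>I. c i \<odot>\<^bsub>M\<^esub> v i | c. True}"

definition finite_dimensional :: "(complex, 'a) module \<Rightarrow> 'a set \<Rightarrow> bool" where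
  "finite_dimensional M W \<longleftrightarrow> (\<exists>d v. is_basis M W {1..d::nat} v)"

definition vdim :: "(complex, 'a) module \<Rightarrow> 'a set \<Rightarrow> nat" where
  "vdim M W = (THE d. \<exists>v. is_basis M W {1..d} v)"

text \<open>The quotient \<open>H / N\<close> of subspaces \<open>N \<subseteq> H\<close> of \<open>M\<close>, realised by cosets.  The fields
  \<^const>\<open>monoid.mult\<close> and \<^const>\<open>monoid.one\<close> are only there because the record requires them.\<close>

definition quotient_space ::
  "(complex, 'a) module \<Rightarrow> 'a set \<Rightarrow> 'a set \<Rightarrow> (complex, 'a set) module" where
  "quotient_space M H N =
     \<lparr>carrier = (\<lambda>x. N +>\<^bsub>M\<^esub> x) ` H, monoid.mult = rcoset_mult M N, one = N +>\<^bsub>M\<^esub> \<one>\<^bsub>M\<^esub>,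
      ring.zero = N, add = set_add M, module.smult = (\<lambda>c C. \<Union>x\<in>C. N +>\<^bsub>M\<^esub> (c \<odot>\<^bsub>M\<^esub> x))\<rparr>"


section \<open>Algebraic actions and weight spaces\<close>

text \<open>Action of \<open>G\<close> by automorphisms of the complex algebra \<open>A\<close>.  The last clause is algebraicity:
  on every \<open>a\<close> the action is given by a coaction \<open>a \<mapsto> \<Sum> u\<^sub>i \<otimes> b\<^sub>i\<close>.\<close>

definition algebraic_action ::
  "'g affine_group \<Rightarrow> (complex, 'a) module \<Rightarrow> ('g \<Rightarrow> 'a \<Rightarrow> 'a) \<Rightarrow> bool" where
  "algebraic_action G A \<rho> \<longleftrightarrow>
     group_action G (carrier A) \<rho> \<and>
     (\<forall>g\<in>carrier G. \<rho> g \<in> ring_hom A A) \<and>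
     (\<forall>g\<in>carrier G. \<forall>c. \<forall>a\<in>carrier A. \<rho> g (c \<odot>\<^bsub>A\<^esub> a) = c \<odot>\<^bsub>A\<^esub> \<rho> g a) \<and>
     (\<forall>a\<in>carrier A. \<exists>(m::nat) u b. (\<forall>i<m. u i \<in> regular G \<and> b i \<in> carrier A) \<and>
        (\<forall>g\<in>carrier G. \<rho> g a = (\<Oplus>\<^bsub>A\<^esub>i\<in>{..<m}. u i g \<odot>\<^bsub>A\<^esub> b i)))"

definition weight_space ::
  "'g affine_group \<Rightarrow> (complex, 'v) module \<Rightarrow> ('g \<Rightarrow> 'v \<Rightarrow> 'v) \<Rightarrow> ('g \<Rightarrow> complex) \<Rightarrow> 'v set" where
  "weight_space G V \<rho> \<chi> = {v \<in> carrier V. \<forall>g\<in>carrier G. \<rho> g v = \<chi> g \<odot>\<^bsub>V\<^esub> v}"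

abbreviation with_rot :: "'t affine_group \<Rightarrow> ('t \<times> complex) affine_group" where
  "with_rot T \<equiv> affine_prod T Gm"

definition T_action :: "('t \<times> complex \<Rightarrow> 'v \<Rightarrow> 'v) \<Rightarrow> 't \<Rightarrow> 'v \<Rightarrow> 'v" where
  "T_action \<rho> = (\<lambda>t. \<rho> (t, 1))"

definition rot_action ::
  "'t affine_group \<Rightarrow> ('t \<times> complex \<Rightarrow> 'v \<Rightarrow> 'v) \<Rightarrow> complex \<Rightarrow> 'v \<Rightarrow> 'v" where
  "rot_action T \<rho> = (\<lambda>z. \<rho> (\<one>\<^bsub>T\<^esub>, z))"

text \<open>The part \<open>V\<^sup>\<noteq>\<^sup>0\<close> of a representation \<open>V\<close> of \<open>T \<times> \<bbbG>\<^sub>m\<close>.\<close>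

definition nontrivial_part ::
  "'t affine_group \<Rightarrow> (complex, 'v) module \<Rightarrow> ('t \<times> complex \<Rightarrow> 'v \<Rightarrow> 'v) \<Rightarrow> 'v set" where
  "nontrivial_part T V \<rho> =
     subspace_sum V (characters T - {trivial_char T}) (weight_space T V (T_action \<rho>))"


section \<open>The ideals and the cotangent space\<close>

definition maximal_ideal_rot ::
  "'t affine_group \<Rightarrow> (complex, 'a) module \<Rightarrow> ('t \<times> complex \<Rightarrow> 'a \<Rightarrow> 'a) \<Rightarrow> 'a set" where
  "maximal_ideal_rot T A \<rho> =
     subspace_sum A (characters T \<times> {k::int. k > 0})
       (\<lambda>(\<chi>, k). weight_space (with_rot T) A \<rho> (char_plus \<chi> k))"

definition maximal_ideal_sq ::
  "'t affine_group \<Rightarrow> (complex, 'a) module \<Rightarrow> ('t \<times> complex \<Rightarrow> 'a \<Rightarrow> 'a) \<Rightarrow> 'a set" where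
  "maximal_ideal_sq T A \<rho> =
     ideal_prod A (maximal_ideal_rot T A \<rho>) (maximal_ideal_rot T A \<rho>)"

definition cotangent ::
  "'t affine_group \<Rightarrow> (complex, 'a) module \<Rightarrow> ('t \<times> complex \<Rightarrow> 'a \<Rightarrow> 'a) \<Rightarrow> (complex, 'a set) module"
  where
  "cotangent T A \<rho> = quotient_space A (maximal_ideal_rot T A \<rho>) (maximal_ideal_sq T A \<rho>)"

text \<open>The induced action on cosets.\<close>

definition induced_action :: "('g \<Rightarrow> 'a \<Rightarrow> 'a) \<Rightarrow> 'g \<Rightarrow> 'a set \<Rightarrow> 'a set" where
  "induced_action \<rho> g C = \<rho> g ` C"

definition fixed_ideal ::
  "'t affine_group \<Rightarrow> (complex, 'a) module \<Rightarrow> ('t \<times> complex \<Rightarrow> 'a \<Rightarrow> 'a) \<Rightarrow> 'a set" where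
  "fixed_ideal T A \<rho> =
     Idl\<^bsub>A\<^esub> (\<Union>\<chi>\<in>characters T - {trivial_char T}. weight_space T A (T_action \<rho>) \<chi>)"

definition minimal_generating_set :: "(complex, 'a) module \<Rightarrow> 'a set \<Rightarrow> 'a set \<Rightarrow> bool" where
  "minimal_generating_set A I S \<longleftrightarrow>
     S \<subseteq> carrier A \<and> Idl\<^bsub>A\<^esub> S = I \<and> (\<forall>S'. S' \<subset> S \<longrightarrow> Idl\<^bsub>A\<^esub> S' \<noteq> I)"

definition min_num_generators :: "(complex, 'a) module \<Rightarrow> 'a set \<Rightarrow> nat" where
  "min_num_generators A I =
     (LEAST n. \<exists>S. S \<subseteq> carrier A \<and> finite S \<and> card S = n \<and> Idl\<^bsub>A\<^esub> S = I)"

end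

(*
  Every element of A is a constant plus an element of the maximal ideal m, so modulo m^2 the ideal
  generated by a finite subset of m is the linear span of that subset.  A homogeneous basis of the
  nontrivial part of m/m^2 is lifted by projecting arbitrary representatives to the prescribed
  weights; m^2 is homogeneous, so the projections still represent the basis.  The lifts generate the
  fixed ideal by induction on the degree: a weight vector of nontrivial T-weight agrees modulo m^2
  with a combination of the lifts, and its error is a sum of products of two homogeneous elements of
  smaller positive degree, one of which has nontrivial T-weight.  Conversely any generating set of
  the fixed ideal spans, modulo m^2, a space containing the given basis, which bounds its size from
  below and also gives minimality.
*)
theory Submission
  imports Defs
begin

section \<open>Linear algebra in complex module records\<close>

text \<open>The degree induction rests on multiplicativity: a product of two weight vectors has
  nontrivial T-weight only if one factor does, and two factors from the maximal ideal have positive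
  degrees that add up, so both are smaller than the degree of the product. Degree zero consists of
  constants, which T fixes; hence nontrivial T-weights occur in positive degree only, and the strong
  induction needs no separate base case. The obstacle is that a weight vector of the cotangent space
  is a coset, so a representative is an eigenvector only modulo the square. The bridge is a
  comparison of eigenvalues: if y is an eigenvector of one group element modulo a homogeneous
  subspace N, then every component of y on which that element has another eigenvalue lies in N.
  Distinct weights are distinct functions on the group, so a separating element exists. Statements
  are phrased as membership of components in a subspace, which avoids convolution sums. The
  Noetherian hypothesis makes the maximal ideal finitely generated, and this yields a finite
  homogeneous basis.\<close>

lemma ring_of_type_algebra_simps [simp]:
  "carrier ring_of_type_algebra = UNIV"
  "add ring_of_type_algebra = (+)"
  "monoid.mult ring_of_type_algebra = (*)"
  "ring.zero ring_of_type_algebra = 0"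
  "one ring_of_type_algebra = 1"
  by (simp_all add: ring_of_type_algebra_def)

text \<open>Gaussian elimination, one equation at a time: a pivot in equation \<open>k\<close>
  removes one unknown from all other equations, which leaves fewer equations than unknowns again.
  Coefficients are plain functions, so the result serves families inside any module record.\<close>

lemma underdetermined_system:
  fixes a :: "'k \<Rightarrow> 'i \<Rightarrow> 'f::field"
  assumes "finite K" "finite I" "card K < card I"
  shows "\<exists>c. (\<exists>i\<in>I. c i \<noteq> 0) \<and> (\<forall>k\<in>K. (\<Sum>i\<in>I. c i * a k i) = 0)"
  using assms
proof (induction K arbitrary: I a rule: finite_induct)
  case empty
  then have "I \<noteq> {}" by auto
  then show ?case by (intro exI[of _ "\<lambda>_. 1"]) auto
next
  case (insert k K)
  show ?case
  proof (cases "\<forall>i\<in>I. a k i = 0")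
    case True
    have "card K < card I" using insert by simp
    then obtain c where "\<exists>i\<in>I. c i \<noteq> 0" "\<forall>k\<in>K. (\<Sum>i\<in>I. c i * a k i) = 0"
      using insert.IH[OF insert.prems(1), of a] by blast
    with True show ?thesis by (intro exI[of _ c]) auto
  next
    case False
    then obtain p where p: "p \<in> I" "a k p \<noteq> 0" by blast
    \<comment> \<open>Row \<open>l\<close> minus the multiple of row \<open>k\<close> that clears
      column \<open>p\<close>.\<close>
    let ?b = "\<lambda>l i. a l i - a k i / a k p * a l p"
    have "card K < card (I - {p})" using insert p by simp
    then obtain c where c: "\<exists>i\<in>I-{p}. c i \<noteq> 0" "\<forall>l\<in>K. (\<Sum>i\<in>I-{p}. c i * ?b l i) = 0"
      using insert.IH[of "I - {p}" ?b] insert.prems by auto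
    define s where "s = (\<Sum>i\<in>I-{p}. c i * a k i)"
    \<comment> \<open>The value at the pivot is the one that makes equation \<open>k\<close>
      hold.\<close>
    let ?d = "c(p := - s / a k p)"
    have split: "(\<Sum>i\<in>I. ?d i * a l i) = - s / a k p * a l p + (\<Sum>i\<in>I-{p}. c i * a l i)" for l
    proof -
      have "(\<Sum>i\<in>I. ?d i * a l i) = ?d p * a l p + (\<Sum>i\<in>I-{p}. ?d i * a l i)"
        using p insert.prems by (simp add: sum.remove)
      also have "(\<Sum>i\<in>I-{p}. ?d i * a l i) = (\<Sum>i\<in>I-{p}. c i * a l i)"
        by (rule sum.cong) auto
      finally show ?thesis by simp
    qed
    have "(\<Sum>i\<in>I. ?d i * a l i) = 0" if "l \<in> insert k K" for l
    proof (cases "l = k")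
      case True
      then show ?thesis unfolding True split using p by (simp add: s_def)
    next
      case False
      then have "0 = (\<Sum>i\<in>I-{p}. c i * ?b l i)" using that c(2) by simp
      also have "\<dots> = (\<Sum>i\<in>I-{p}. c i * a l i) - (\<Sum>i\<in>I-{p}. c i * a k i * (a l p / a k p))"
        by (simp add: sum_subtractf algebra_simps)
      also have "(\<Sum>i\<in>I-{p}. c i * a k i * (a l p / a k p)) = s * (a l p / a k p)"
        by (simp add: s_def sum_distrib_right sum_divide_distrib)
      finally show ?thesis unfolding split by (simp add: algebra_simps)
    qed
    moreover have "\<exists>i\<in>I. ?d i \<noteq> 0" using c(1) by auto
    ultimately show ?thesis by (intro exI[of _ ?d]) auto
  qed
qed

text \<open>Additivity is asked for on \<open>H\<close> alone because the coset map lands in the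
  carrier of a quotient only on the subspace being divided. An infinite \<open>J\<close> is allowed,
  since \<open>finsum\<close> is then zero by convention.\<close>

lemma finsum_hom_closed:
  assumes "abelian_monoid M" "abelian_monoid N"
    and H: "H \<subseteq> carrier M" "\<zero>\<^bsub>M\<^esub> \<in> H" "\<And>x y. x \<in> H \<Longrightarrow> y \<in> H \<Longrightarrow> x \<oplus>\<^bsub>M\<^esub> y \<in> H"
    and h: "h \<in> H \<rightarrow> carrier N" "h \<zero>\<^bsub>M\<^esub> = \<zero>\<^bsub>N\<^esub>"
      "\<And>x y. x \<in> H \<Longrightarrow> y \<in> H \<Longrightarrow> h (x \<oplus>\<^bsub>M\<^esub> y) = h x \<oplus>\<^bsub>N\<^esub> h y"
    and f: "f \<in> J \<rightarrow> H"
  shows "finsum M f J \<in> H \<and> h (finsum M f J) = finsum N (\<lambda>i. h (f i)) J"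
proof -
  interpret M: abelian_monoid M by fact
  interpret N: abelian_monoid N by fact
  show ?thesis using f
  proof (induction J rule: infinite_finite_induct)
    case (insert i J)
    have "f \<in> J \<rightarrow> carrier M" "f i \<in> carrier M" using insert.prems H(1) by auto
    then have eq: "finsum M f (insert i J) = f i \<oplus>\<^bsub>M\<^esub> finsum M f J"
      using insert by (intro M.finsum_insert) auto
    have "finsum N (\<lambda>i. h (f i)) (insert i J) = h (f i) \<oplus>\<^bsub>N\<^esub> finsum N (\<lambda>i. h (f i)) J"
      using insert h(1) by (intro N.finsum_insert) auto
    with insert eq H h show ?case by auto
  qed (use H h in auto)
qed

lemma (in abelian_monoid) finsum_mem:
  assumes "H \<subseteq> carrier G" "\<zero> \<in> H" "\<And>x y. x \<in> H \<Longrightarrow> y \<in> H \<Longrightarrow> x \<oplus> y \<in> H" "f \<in> J \<rightarrow> H"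
  shows "finsum G f J \<in> H"
  using finsum_hom_closed[OF abelian_monoid_axioms abelian_monoid_axioms assms(1-3), of "\<lambda>x. x" f J] assms
  by (auto simp: subset_iff)

text \<open>Scalars are the type \<open>complex\<close> itself. The module laws are restated below
  in the arithmetic of that type, so that they combine with field simplification.\<close>

locale complex_module =
  fixes M :: "(complex, 'a) module" (structure)
  assumes is_module: "module (ring_of_type_algebra :: complex ring) M"

sublocale complex_module \<subseteq> abelian_group M
  using is_module by (simp add: module_def)

context complex_module
begin

lemma smult_closed [simp, intro]: "x \<in> carrier M \<Longrightarrow> c \<odot> x \<in> carrier M"
  using module.smult_closed[OF is_module] by simp

lemma smult_add_left: "x \<in> carrier M \<Longrightarrow> (a + b) \<odot> x = a \<odot> x \<oplus> b \<odot> x"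
  using module.smult_l_distr[OF is_module, of a b x] by simp

lemma smult_add_right:
  "x \<in> carrier M \<Longrightarrow> y \<in> carrier M \<Longrightarrow> a \<odot> (x \<oplus> y) = a \<odot> x \<oplus> a \<odot> y"
  using module.smult_r_distr[OF is_module, of a x y] by simp

lemma smult_smult: "x \<in> carrier M \<Longrightarrow> a \<odot> (b \<odot> x) = (a * b) \<odot> x"
  using module.smult_assoc1[OF is_module, of a b x] by simp

lemma smult_one [simp]: "x \<in> carrier M \<Longrightarrow> 1 \<odot> x = x"
  using module.smult_one[OF is_module, of x] by simp

lemma smult_zero_left [simp]: "x \<in> carrier M \<Longrightarrow> 0 \<odot> x = \<zero>"
  using module.smult_l_null[OF is_module, of x] by simp

lemma smult_zero_right [simp]: "c \<odot> \<zero> = \<zero>"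
  using module.smult_r_null[OF is_module, of c] by simp

lemma smult_minus_one: "x \<in> carrier M \<Longrightarrow> (-1) \<odot> x = \<ominus> x"
  by (rule minus_equality[symmetric]) (use smult_add_left[of x "-1" 1] in auto)

lemma minus_eq_smult: "x \<in> carrier M \<Longrightarrow> y \<in> carrier M \<Longrightarrow> x \<ominus> y = x \<oplus> (-1) \<odot> y"
  by (simp add: a_minus_def smult_minus_one)

lemma smult_cancel: "x \<in> carrier M \<Longrightarrow> c \<odot> x = \<zero> \<Longrightarrow> c \<noteq> 0 \<Longrightarrow> x = \<zero>"
  by (metis smult_smult smult_one smult_zero_right left_inverse)

lemma add_eq_zero_smult:
  assumes "x \<in> carrier M" "y \<in> carrier M" "c \<odot> x \<oplus> y = \<zero>" "c \<noteq> 0"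
  shows "x = (- 1 / c) \<odot> y"
proof -
  have "c \<odot> x = \<ominus> y" using assms by (intro add.inv_equality[symmetric]) auto
  then have "inverse c \<odot> (c \<odot> x) = inverse c \<odot> ((-1) \<odot> y)" using assms by (simp add: smult_minus_one)
  then show ?thesis using assms by (simp add: smult_smult divide_inverse)
qed

section \<open>Linear combinations, dimension and bases\<close>

abbreviation lincomb :: "('i \<Rightarrow> complex) \<Rightarrow> ('i \<Rightarrow> 'a) \<Rightarrow> 'i set \<Rightarrow> 'a" where
  "lincomb c v I \<equiv> (\<Oplus>i\<in>I. c i \<odot> v i)"

lemma lincomb_closed: "v \<in> I \<rightarrow> carrier M \<Longrightarrow> lincomb c v I \<in> carrier M"
  by (intro finsum_closed) auto

lemma lincomb_add:
  assumes "v \<in> I \<rightarrow> carrier M"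
  shows "lincomb (\<lambda>i. a i + b i) v I = lincomb a v I \<oplus> lincomb b v I"
proof -
  have "lincomb (\<lambda>i. a i + b i) v I = (\<Oplus>i\<in>I. a i \<odot> v i \<oplus> b i \<odot> v i)"
    using assms by (intro finsum_cong') (auto simp: smult_add_left Pi_iff)
  also have "\<dots> = lincomb a v I \<oplus> lincomb b v I"
    using assms by (intro finsum_addf) auto
  finally show ?thesis .
qed

lemma lincomb_scale:
  assumes "v \<in> I \<rightarrow> carrier M"
  shows "lincomb (\<lambda>i. c * a i) v I = c \<odot> lincomb a v I"
proof -
  have "c \<odot> lincomb a v I = (\<Oplus>i\<in>I. c \<odot> (a i \<odot> v i))"
    using finsum_hom_closed[OF abelian_monoid_axioms abelian_monoid_axioms, of "carrier M" "\<lambda>x. c \<odot> x"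
        "\<lambda>i. a i \<odot> v i" I] assms by (auto simp: smult_add_right)
  also have "\<dots> = lincomb (\<lambda>i. c * a i) v I"
    using assms by (intro finsum_cong') (auto simp: smult_smult Pi_iff)
  finally show ?thesis by simp
qed

lemma lincomb_cong:
  assumes "v \<in> I \<rightarrow> carrier M" "\<And>i. i \<in> I \<Longrightarrow> a i = b i" "\<And>i. i \<in> I \<Longrightarrow> u i = v i"
  shows "lincomb a u I = lincomb b v I"
  using assms by (intro finsum_cong') auto

lemma lincomb_zero: "v \<in> I \<rightarrow> carrier M \<Longrightarrow> (\<And>i. i \<in> I \<Longrightarrow> c i = 0) \<Longrightarrow> lincomb c v I = \<zero>"
  by (intro add.finprod_one_eqI) (auto simp: Pi_iff)

lemma lincomb_remove:
  assumes "v \<in> I \<rightarrow> carrier M" "finite I" "p \<in> I"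
  shows "lincomb c v I = c p \<odot> v p \<oplus> lincomb c v (I - {p})"
proof -
  have "lincomb c v (insert p (I - {p})) = c p \<odot> v p \<oplus> lincomb c v (I - {p})"
    using assms by (intro finsum_insert) auto
  then show ?thesis using assms by (simp add: insert_absorb)
qed

lemma lincomb_single:
  assumes "v \<in> I \<rightarrow> carrier M" "finite I" "p \<in> I"
  shows "lincomb (\<lambda>i. if i = p then 1 else 0) v I = v p"
proof -
  have "lincomb (\<lambda>i. if i = p then 1 else 0) v (I - {p}) = \<zero>"
    using assms by (intro lincomb_zero) auto
  then show ?thesis using assms lincomb_remove[OF assms, of "\<lambda>i. if i = p then 1 else 0"]
    by (simp add: Pi_iff)
qed

text \<open>Substitution of coefficients, that is, a matrix product. It turns a relation among
  combinations into a linear system for the coefficients.\<close>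

lemma lincomb_lincomb:
  assumes "finite I" "u \<in> K \<rightarrow> carrier M"
  shows "lincomb c (\<lambda>i. lincomb (a i) u K) I = lincomb (\<lambda>k. \<Sum>i\<in>I. c i * a i k) u K"
  using assms(1)
proof (induction rule: finite_induct)
  case empty
  then show ?case using assms lincomb_zero[of u K "\<lambda>_. 0"] by simp
next
  case (insert p I)
  have "lincomb c (\<lambda>i. lincomb (a i) u K) (insert p I)
      = c p \<odot> lincomb (a p) u K \<oplus> lincomb c (\<lambda>i. lincomb (a i) u K) I"
    using insert assms by (intro finsum_insert) (auto intro!: lincomb_closed)
  also have "\<dots> = lincomb (\<lambda>k. c p * a p k) u K \<oplus> lincomb (\<lambda>k. \<Sum>i\<in>I. c i * a i k) u K"
    using insert assms by (simp add: lincomb_scale)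
  also have "\<dots> = lincomb (\<lambda>k. c p * a p k + (\<Sum>i\<in>I. c i * a i k)) u K"
    using assms by (simp add: lincomb_add)
  finally show ?case using insert by simp
qed

text \<open>With more vectors \<open>v i\<close> than spanning vectors \<open>u k\<close>, the
  homogeneous system for the coefficients of a relation would have a nonzero solution. The same
  bound yields invariance of dimension and the lower bound on the number of generators.\<close>

lemma independent_card_le:
  assumes "finite I" "finite K" "u \<in> K \<rightarrow> carrier M"
    and span: "\<And>i. i \<in> I \<Longrightarrow> \<exists>a. v i = lincomb a u K"
    and indep: "\<And>c. lincomb c v I = \<zero> \<Longrightarrow> \<forall>i\<in>I. c i = 0"
  shows "card I \<le> card K"
proof (rule ccontr)
  assume "\<not> card I \<le> card K"
  then have card: "card K < card I" by simp
  obtain a where a: "\<And>i. i \<in> I \<Longrightarrow> v i = lincomb (a i) u K" using span by metis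
  obtain c where c: "\<exists>i\<in>I. c i \<noteq> 0" "\<forall>k\<in>K. (\<Sum>i\<in>I. c i * a i k) = 0"
    using underdetermined_system[OF assms(2,1) card, of "\<lambda>k i. a i k"] by blast
  have "lincomb c v I = lincomb c (\<lambda>i. lincomb (a i) u K) I"
    using a assms by (intro lincomb_cong) (auto intro!: lincomb_closed)
  also have "\<dots> = \<zero>"
    using assms c by (simp add: lincomb_lincomb lincomb_zero)
  finally show False using indep c(1) by blast
qed

lemma is_basis_card_unique:
  assumes "W \<subseteq> carrier M" "is_basis M W I v" "is_basis M W K u"
  shows "card I = card K"
proof -
  have *: "card I \<le> card K" if "is_basis M W I v" "is_basis M W K u"
    for I v and K :: "'k set" and u
    using that assms(1) unfolding is_basis_def
    by (intro independent_card_le[of I K u v]) (auto simp: Pi_iff subset_iff)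
  have **: "card K \<le> card I" if "is_basis M W I v" "is_basis M W K u"
    for I v and K :: "'k set" and u
    using that assms(1) unfolding is_basis_def
    by (intro independent_card_le[of K I v u]) (auto simp: Pi_iff subset_iff)
  show ?thesis using *[OF assms(2,3)] **[OF assms(2,3)] by simp
qed

lemma vdim_eq:
  assumes "W \<subseteq> carrier M" "is_basis M W {1..n} v"
  shows "vdim M W = n"
  unfolding vdim_def
proof (rule the_equality)
  show "\<exists>v. is_basis M W {1..n} v" using assms by blast
  show "d = n" if "\<exists>v. is_basis M W {1..d} v" for d
    using that is_basis_card_unique[OF assms(1) _ assms(2)] by fastforce
qed

text \<open>In a dependent family some member is a combination of the others, and dropping it keeps
  the span. Choosing a subfamily rather than forming new vectors matters later: a basis extracted
  from homogeneous vectors is again homogeneous.\<close>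

lemma spanning_contains_basis:
  assumes "W \<subseteq> carrier M" "finite K" "u \<in> K \<rightarrow> W" "W = {lincomb c u K | c. True}"
  shows "\<exists>K'\<subseteq>K. is_basis M W K' u"
  using assms(2-4)
proof (induction K rule: finite_psubset_induct)
  case (psubset K)
  have u: "u \<in> K \<rightarrow> carrier M" using psubset.prems assms(1) by auto
  show ?case
  proof (cases "\<forall>c. lincomb c u K = \<zero> \<longrightarrow> (\<forall>i\<in>K. c i = 0)")
    case True
    then have "is_basis M W K u" using psubset unfolding is_basis_def by blast
    then show ?thesis by blast
  next
    case False
    then obtain c p where c: "lincomb c u K = \<zero>" "p \<in> K" "c p \<noteq> 0" by blast
    let ?K = "K - {p}"
    have uK: "u \<in> ?K \<rightarrow> carrier M" using u by auto
    have "c p \<odot> u p \<oplus> lincomb c u ?K = \<zero>"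
      using lincomb_remove[OF u psubset.hyps(1) c(2), of c] c by simp
    then have up: "u p = (- 1 / c p) \<odot> lincomb c u ?K"
      using u c lincomb_closed[OF uK, of c] by (intro add_eq_zero_smult) auto
    have le: "\<exists>b. lincomb a u K = lincomb b u ?K" for a
    proof -
      have "lincomb a u K = a p \<odot> ((- 1 / c p) \<odot> lincomb c u ?K) \<oplus> lincomb a u ?K"
        using lincomb_remove[OF u psubset.hyps(1) c(2), of a] up by simp
      also have "\<dots> = lincomb (\<lambda>i. (a p * (- 1 / c p)) * c i + a i) u ?K"
        using uK by (simp add: lincomb_closed lincomb_scale smult_smult lincomb_add del: mult_minus_right)
      finally show ?thesis by (intro exI)
    qed
    have ge: "\<exists>b. lincomb a u ?K = lincomb b u K" for a
    proof -
      have "lincomb (a(p := 0)) u K = (a(p := 0)) p \<odot> u p \<oplus> lincomb (a(p := 0)) u ?K"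
        using lincomb_remove[OF u psubset.hyps(1) c(2)] .
      also have "\<dots> = lincomb (a(p := 0)) u ?K"
        using u uK c(2) lincomb_closed[OF uK, of "a(p:=0)"] by (auto simp: Pi_iff)
      also have "\<dots> = lincomb a u ?K" using uK by (intro lincomb_cong) auto
      finally show ?thesis by metis
    qed
    have "{lincomb c u K | c. True} = {lincomb c u ?K | c. True}" (is "?L = ?R")
    proof (intro subset_antisym subsetI)
      show "x \<in> ?R" if "x \<in> ?L" for x using that le by force
      show "x \<in> ?L" if "x \<in> ?R" for x using that ge by force
    qed
    then have "W = {lincomb c u ?K | c. True}" using psubset.prems(2) by (rule trans[rotated])
    then obtain K' where "K' \<subseteq> ?K" "is_basis M W K' u"
      using psubset.IH[of ?K] psubset.prems c by auto
    then show ?thesis by blast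
  qed
qed

text \<open>An extracted basis is indexed by its own vectors, whereas
  \<open>finite_dimensional\<close> and \<open>vdim\<close> ask for the index set
  \<open>{1..n}\<close>. Coefficients are carried back along the inverse bijection.\<close>

lemma is_basis_reindex:
  assumes "W \<subseteq> carrier M" "is_basis M W K u" "bij_betw h I K" "finite I"
  shows "is_basis M W I (u \<circ> h)"
proof -
  have inj: "inj_on h I" and im: "h ` I = K" using assms(3) by (auto simp: bij_betw_def)
  have u: "u \<in> K \<rightarrow> W" using assms(2) unfolding is_basis_def by blast
  then have uc: "u \<in> K \<rightarrow> carrier M" using assms(1) by auto
  have re: "lincomb c u K = lincomb (c \<circ> h) (u \<circ> h) I" for c
    using finsum_reindex[of "\<lambda>k. c k \<odot> u k" h I] inj im uc by auto
  let ?g = "the_inv_into I h"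
  have re': "lincomb c (u \<circ> h) I = lincomb (c \<circ> ?g) u K" for c
    unfolding re using uc im inj
    by (intro lincomb_cong) (auto simp: the_inv_into_f_f)
  have g: "i \<in> I \<Longrightarrow> ?g (h i) = i" for i using inj by (simp add: the_inv_into_f_f)
  have ind: "(\<forall>i\<in>I. c i = 0)" if "lincomb c (u \<circ> h) I = \<zero>" for c
  proof -
    have "\<forall>k\<in>K. (c \<circ> ?g) k = 0" using that assms(2) unfolding re' is_basis_def by blast
    then show ?thesis using im g by fastforce
  qed
  have "W = {lincomb c u K | c. True}" using assms(2) unfolding is_basis_def by blast
  also have "\<dots> = {lincomb c (u \<circ> h) I | c. True}"
    using re re' by blast
  finally have W: "W = {lincomb c (u \<circ> h) I | c. True}" .
  have "u \<circ> h \<in> I \<rightarrow> W" using u im by auto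
  then show ?thesis unfolding is_basis_def using assms(4) ind W by blast
qed

end

section \<open>Subspaces and quotients\<close>

context complex_module
begin

definition csubspace :: "'a set \<Rightarrow> bool" where
  "csubspace H \<longleftrightarrow> H \<subseteq> carrier M \<and> \<zero> \<in> H \<and> (\<forall>x\<in>H. \<forall>y\<in>H. x \<oplus> y \<in> H) \<and> (\<forall>c. \<forall>x\<in>H. c \<odot> x \<in> H)"

lemma csubspaceI:
  assumes "H \<subseteq> carrier M" "\<zero> \<in> H" "\<And>x y. x \<in> H \<Longrightarrow> y \<in> H \<Longrightarrow> x \<oplus> y \<in> H"
    "\<And>c x. x \<in> H \<Longrightarrow> c \<odot> x \<in> H"
  shows "csubspace H"
  using assms by (auto simp: csubspace_def)

lemma csubspaceD:
  assumes "csubspace H"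
  shows "H \<subseteq> carrier M" "x \<in> H \<Longrightarrow> x \<in> carrier M" "\<zero> \<in> H" "x \<in> H \<Longrightarrow> y \<in> H \<Longrightarrow> x \<oplus> y \<in> H"
    "x \<in> H \<Longrightarrow> c \<odot> x \<in> H" "x \<in> H \<Longrightarrow> y \<in> H \<Longrightarrow> x \<ominus> y \<in> H"
  using assms unfolding csubspace_def by (auto simp: minus_eq_smult subset_iff)

lemma csubspace_finsum: "csubspace H \<Longrightarrow> f \<in> J \<rightarrow> H \<Longrightarrow> finsum M f J \<in> H"
  by (rule finsum_mem) (auto dest: csubspaceD)

lemma csubspace_lincomb: "csubspace H \<Longrightarrow> v \<in> J \<rightarrow> H \<Longrightarrow> lincomb c v J \<in> H"
  by (rule csubspace_finsum) (auto dest: csubspaceD)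

lemma csubspace_diff_cancel:
  assumes "csubspace H" "x \<ominus> y \<in> H" "y \<in> H" "x \<in> carrier M"
  shows "x \<in> H"
proof -
  have "x \<ominus> y \<oplus> y = x" using assms csubspaceD(2)[OF assms(1,3)]
    by (simp add: a_minus_def a_assoc l_neg)
  then show ?thesis using csubspaceD(4)[OF assms(1-3)] by simp
qed

lemma subspace_sum_mem: "i \<in> I \<Longrightarrow> x \<in> V i \<Longrightarrow> x \<in> carrier M \<Longrightarrow> x \<in> subspace_sum M I V"
  unfolding subspace_sum_def by (intro CollectI exI[of _ "\<lambda>_. x"] exI[of _ "{i}"]) auto

lemma subspace_sum_least:
  "csubspace U \<Longrightarrow> (\<And>i. i \<in> I \<Longrightarrow> V i \<subseteq> U) \<Longrightarrow> subspace_sum M I V \<subseteq> U"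
  unfolding subspace_sum_def by (auto intro!: csubspace_finsum)

lemma finsum_extend:
  assumes "finite K" "J \<subseteq> K" "f \<in> J \<rightarrow> carrier M"
  shows "finsum M f J = (\<Oplus>i\<in>K. if i \<in> J then f i else \<zero>)"
  using assms by (intro add.finprod_mono_neutral_cong_left) auto

lemma csubspace_subspace_sum:
  assumes V: "\<And>i. i \<in> I \<Longrightarrow> csubspace (V i)"
  shows "csubspace (subspace_sum M I V)"
proof (rule csubspaceI)
  have VM: "f \<in> J \<rightarrow> carrier M" if "J \<subseteq> I" "f \<in> (\<Pi> i\<in>J. V i)" for J f
    using that V by (auto simp: Pi_iff subset_iff dest: csubspaceD)
  show "subspace_sum M I V \<subseteq> carrier M"
    unfolding subspace_sum_def using VM by auto
  show "\<zero> \<in> subspace_sum M I V"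
    unfolding subspace_sum_def by (intro CollectI exI[of _ "\<lambda>_. \<zero>"] exI[of _ "{}"]) auto
  show "x \<oplus> y \<in> subspace_sum M I V" if xy: "x \<in> subspace_sum M I V" "y \<in> subspace_sum M I V" for x y
  proof -
    obtain f J g K where f: "x = finsum M f J" "finite J" "J \<subseteq> I" "f \<in> (\<Pi> i\<in>J. V i)"
      and g: "y = finsum M g K" "finite K" "K \<subseteq> I" "g \<in> (\<Pi> i\<in>K. V i)"
      using xy unfolding subspace_sum_def by blast
    \<comment> \<open>Padding by zero puts both families on the common index set
      \<open>J \<union> K\<close>.\<close>
    let ?f = "\<lambda>i. if i \<in> J then f i else \<zero>" and ?g = "\<lambda>i. if i \<in> K then g i else \<zero>"
    have "x = finsum M ?f (J \<union> K)" "y = finsum M ?g (J \<union> K)"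
      using f g VM finsum_extend[of "J \<union> K"] by auto
    moreover have fM: "?f \<in> J \<union> K \<rightarrow> carrier M" and gM: "?g \<in> J \<union> K \<rightarrow> carrier M"
      using VM[OF f(3,4)] VM[OF g(3,4)] by auto
    ultimately have "x \<oplus> y = (\<Oplus>i\<in>J \<union> K. ?f i \<oplus> ?g i)"
      using finsum_addf[OF fM gM] by simp
    moreover have "?f i \<oplus> ?g i \<in> V i" if i: "i \<in> J \<union> K" for i
    proof (rule csubspaceD(4))
      show "csubspace (V i)" using V i f g by blast
      then show "?f i \<in> V i" "?g i \<in> V i" using f g by (auto dest: csubspaceD)
    qed
    then have "(\<lambda>i. ?f i \<oplus> ?g i) \<in> (\<Pi> i\<in>J \<union> K. V i)" by blast
    ultimately show ?thesis unfolding subspace_sum_def using f g by blast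
  qed
  show "c \<odot> x \<in> subspace_sum M I V" if x: "x \<in> subspace_sum M I V" for c x
  proof -
    obtain f J where f: "x = finsum M f J" "finite J" "J \<subseteq> I" "f \<in> (\<Pi> i\<in>J. V i)"
      using x unfolding subspace_sum_def by blast
    have "c \<odot> x = lincomb (\<lambda>_. c) f J"
      using finsum_hom_closed[OF abelian_monoid_axioms abelian_monoid_axioms, of "carrier M" "\<lambda>x. c \<odot> x" f J]
        VM[OF f(3,4)] f by (auto simp: smult_add_right)
    moreover have "(\<lambda>i. c \<odot> f i) \<in> (\<Pi> i\<in>J. V i)"
      using f V by (auto simp: Pi_iff subset_iff intro!: csubspaceD)
    ultimately show ?thesis unfolding subspace_sum_def using f by blast
  qed
qed

end

locale complex_module_quotient = complex_module +
  fixes H N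
  assumes H: "csubspace H" and N: "csubspace N" and NH: "N \<subseteq> H"
begin

lemma N_subgroup: "subgroup N (add_monoid M)"
  using csubspaceD[OF N] by (intro add.subgroupI) (auto simp flip: smult_minus_one)

sublocale N: abelian_subgroup N M
  using N_subgroup by (intro abelian_subgroupI3 additive_subgroupI abelian_group_axioms)

abbreviation Q where "Q \<equiv> quotient_space M H N"

lemma H_carrier: "x \<in> H \<Longrightarrow> x \<in> carrier M"
  using csubspaceD(2)[OF H] .

lemma coset_eq_iff:
  assumes "x \<in> carrier M" "y \<in> carrier M"
  shows "N +> x = N +> y \<longleftrightarrow> x \<ominus> y \<in> N"
proof -
  have "N +> x = N +> y \<longleftrightarrow> x \<in> N +> y"
    using assms N.a_repr_independence'[of x y] N.a_repr_independenceD[of x y] by auto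
  then show ?thesis using N.a_rcos_module[of y x] assms by (simp add: a_minus_def)
qed

lemma coset_eq_zero_iff: "x \<in> carrier M \<Longrightarrow> N +> x = N \<longleftrightarrow> x \<in> N"
  using coset_eq_iff[of x \<zero>] csubspaceD(1)[OF N]
  by (simp add: a_coset_add_zero minus_eq_smult)

lemma carrier_Q: "carrier Q = (\<lambda>x. N +> x) ` H"
  and zero_Q: "\<zero>\<^bsub>Q\<^esub> = N"
  by (simp_all add: quotient_space_def)

lemma zero_Q_coset: "\<zero>\<^bsub>Q\<^esub> = N +> \<zero>"
  using csubspaceD(1)[OF N] by (simp add: zero_Q)

lemma add_Q: "x \<in> carrier M \<Longrightarrow> y \<in> carrier M \<Longrightarrow> (N +> x) \<oplus>\<^bsub>Q\<^esub> (N +> y) = N +> (x \<oplus> y)"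
  by (simp add: quotient_space_def N.a_rcos_sum)

text \<open>The scalar multiple of a coset is defined as a union over its representatives. All of
  them give the same coset because \<open>N\<close> is closed under scalars, and a union of a
  constant nonempty family is that constant.\<close>

lemma smult_Q:
  assumes "x \<in> carrier M"
  shows "c \<odot>\<^bsub>Q\<^esub> (N +> x) = N +> (c \<odot> x)"
proof -
  have "N +> (c \<odot> y) = N +> (c \<odot> x)" if "y \<in> N +> x" for y
  proof -
    have y: "y \<in> carrier M" using N.a_elemrcos_carrier[OF assms that] .
    then have "y \<ominus> x \<in> N" using that assms by (simp add: N.a_rcos_module a_minus_def)
    then have "c \<odot> (y \<ominus> x) \<in> N" by (rule csubspaceD(5)[OF N])
    moreover have "c \<odot> (y \<ominus> x) = c \<odot> y \<ominus> c \<odot> x"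
      using y assms by (simp add: minus_eq_smult smult_add_right smult_smult)
    ultimately show ?thesis using y assms by (simp add: coset_eq_iff)
  qed
  then have "(\<Union>y\<in>N +> x. N +> (c \<odot> y)) = (\<Union>y\<in>N +> x. N +> (c \<odot> x))"
    by (intro SUP_cong refl)
  moreover have "N +> x \<noteq> {}" using N.a_rcos_self[OF assms] by blast
  ultimately show ?thesis unfolding quotient_space_def by simp
qed

lemma complex_module_Q: "complex_module Q"
proof (rule complex_module.intro, rule moduleI)
  show "cring (ring_of_type_algebra :: complex ring)" using is_module by (simp add: module_def)
  show "abelian_group Q"
  proof (rule abelian_groupI)
    show "\<exists>y\<in>carrier Q. y \<oplus>\<^bsub>Q\<^esub> x = \<zero>\<^bsub>Q\<^esub>" if x: "x \<in> carrier Q" for x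
    proof -
      obtain y where y: "y \<in> H" "x = N +> y" using x carrier_Q by auto
      then have "(N +> ((-1) \<odot> y)) \<oplus>\<^bsub>Q\<^esub> x = \<zero>\<^bsub>Q\<^esub>"
        using H_carrier
        by (simp add: add_Q smult_minus_one l_neg zero_Q_coset)
      then show ?thesis using carrier_Q y csubspaceD(5)[OF H, of y "-1"] by blast
    qed
  qed (use csubspaceD(3,4)[OF H] H_carrier in \<open>auto simp: carrier_Q add_Q zero_Q_coset a_ac\<close>)
qed (use csubspaceD(5)[OF H] H_carrier in
    \<open>auto simp: carrier_Q add_Q smult_Q smult_add_left smult_add_right smult_smult\<close>)

sublocale Q: complex_module Q
  by (rule complex_module_Q)

lemma coset_finsum:
  assumes "f \<in> J \<rightarrow> H"
  shows "finsum Q (\<lambda>i. N +> f i) J = N +> finsum M f J"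
  using finsum_hom_closed[OF abelian_monoid_axioms Q.abelian_monoid_axioms, of H "\<lambda>x. N +> x" f J]
    csubspaceD(1,3,4)[OF H] assms
  by (simp add: carrier_Q zero_Q_coset add_Q H_carrier Pi_iff)

lemma coset_lincomb:
  assumes "v \<in> J \<rightarrow> H"
  shows "Q.lincomb c (\<lambda>i. N +> v i) J = N +> lincomb c v J"
proof -
  have "Q.lincomb c (\<lambda>i. N +> v i) J = finsum Q (\<lambda>i. N +> (c i \<odot> v i)) J"
    using assms csubspaceD(5)[OF H] H_carrier
    by (intro Q.finsum_cong') (auto simp: carrier_Q smult_Q Pi_iff)
  also have "\<dots> = N +> lincomb c v J"
    using assms csubspaceD(5)[OF H] by (intro coset_finsum) auto
  finally show ?thesis .
qed

end

section \<open>Weight decompositions of algebras\<close>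

text \<open>Weights are indexed by an abstract set with a function \<open>ch\<close> to functions on
  the group, so that projections can be developed without splitting a weight into a character and a
  degree.\<close>

locale weighted_algebra =
  fixes G :: "'g affine_group"
    and A :: "(complex, 'a) module" (structure)
    and \<rho> :: "'g \<Rightarrow> 'a \<Rightarrow> 'a"
    and \<Lambda> :: "'w set"
    and ch :: "'w \<Rightarrow> 'g \<Rightarrow> complex"
  assumes algebra: "algebra (ring_of_type_algebra :: complex ring) A"
    and action: "algebraic_action G A \<rho>"
    and direct: "is_direct_sum A \<Lambda> (\<lambda>w. weight_space G A \<rho> (ch w))"
    and separated: "\<And>v w. v \<in> \<Lambda> \<Longrightarrow> w \<in> \<Lambda> \<Longrightarrow> v \<noteq> w \<Longrightarrow> \<exists>g\<in>carrier G. ch v g \<noteq> ch w g"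

sublocale weighted_algebra \<subseteq> complex_module A
  using algebra by (intro complex_module.intro) (simp add: algebra_def)

sublocale weighted_algebra \<subseteq> cring A
  using algebra by (simp add: algebra_def)

context weighted_algebra
begin

lemma smult_mult_left: "x \<in> carrier A \<Longrightarrow> y \<in> carrier A \<Longrightarrow> (c \<odot> x) \<otimes> y = c \<odot> (x \<otimes> y)"
  using algebra.smult_assoc2[OF algebra, of c x y] by simp

lemma smult_mult_right: "x \<in> carrier A \<Longrightarrow> y \<in> carrier A \<Longrightarrow> x \<otimes> (c \<odot> y) = c \<odot> (x \<otimes> y)"
  using smult_mult_left[of y x c] by (simp add: m_comm)

text \<open>Scaling by \<open>c\<close> is ring multiplication by
  \<open>c \<odot> \<one>\<close>.\<close>

lemma ideal_csubspace:
  assumes "ideal I A"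
  shows "csubspace I"
proof -
  interpret I: ideal I A by fact
  show ?thesis
  proof (rule csubspaceI)
    show "c \<odot> x \<in> I" if "x \<in> I" for c x
      using I.I_l_closed[OF that, of "c \<odot> \<one>"] I.a_Hcarr[OF that] by (simp add: smult_mult_left)
  qed (use I.a_Hcarr in auto)
qed

lemma csubspace_ideal:
  assumes "csubspace I" "\<And>a x. a \<in> carrier A \<Longrightarrow> x \<in> I \<Longrightarrow> a \<otimes> x \<in> I"
  shows "ideal I A"
proof (rule idealI)
  show "subgroup I (add_monoid A)"
    using csubspaceD(1-5)[OF assms(1)]
    by (intro add.subgroupI) (auto simp flip: smult_minus_one)
  show "x \<otimes> a \<in> I" if "a \<in> I" "x \<in> carrier A" for a x using assms(2) that by blast
  then show "a \<otimes> x \<in> I" if "a \<in> I" "x \<in> carrier A" for a x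
    using that csubspaceD(2)[OF assms(1)] m_comm by metis
qed (rule ring_axioms)

abbreviation wt :: "'w \<Rightarrow> 'a set" where
  "wt w \<equiv> weight_space G A \<rho> (ch w)"

lemma group_G: "group G"
  using action by (simp add: algebraic_action_def group_action_def group_hom_def)

lemma act_closed [simp]: "g \<in> carrier G \<Longrightarrow> x \<in> carrier A \<Longrightarrow> \<rho> g x \<in> carrier A"
  and act_mult: "g \<in> carrier G \<Longrightarrow> x \<in> carrier A \<Longrightarrow> y \<in> carrier A \<Longrightarrow> \<rho> g (x \<otimes> y) = \<rho> g x \<otimes> \<rho> g y"
  and act_add: "g \<in> carrier G \<Longrightarrow> x \<in> carrier A \<Longrightarrow> y \<in> carrier A \<Longrightarrow> \<rho> g (x \<oplus> y) = \<rho> g x \<oplus> \<rho> g y"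
  and act_one: "g \<in> carrier G \<Longrightarrow> \<rho> g \<one> = \<one>"
  and act_smult: "g \<in> carrier G \<Longrightarrow> x \<in> carrier A \<Longrightarrow> \<rho> g (c \<odot> x) = c \<odot> \<rho> g x"
  using action by (auto simp: algebraic_action_def ring_hom_def)

lemma act_zero [simp]: "g \<in> carrier G \<Longrightarrow> \<rho> g \<zero> = \<zero>"
  using act_smult[of g \<zero> 0] by simp

lemma act_inv:
  assumes "g \<in> carrier G" "x \<in> carrier A"
  shows "\<rho> g (\<rho> (inv\<^bsub>G\<^esub> g) x) = x"
proof -
  interpret group_action G "carrier A" \<rho> using action by (simp add: algebraic_action_def)
  show ?thesis
    using composition_rule[of x g "inv\<^bsub>G\<^esub> g"] id_eq_one assms group_G
    by (metis group.inv_closed group.r_inv restrict_apply')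
qed

lemma csubspace_weight_space: "csubspace (weight_space G A \<rho> \<chi>)"
  by (rule csubspaceI)
    (auto simp: weight_space_def act_add act_smult smult_add_right smult_smult mult.commute)

lemma wt_carrier: "x \<in> weight_space G A \<rho> \<chi> \<Longrightarrow> x \<in> carrier A"
  by (simp add: weight_space_def)

section \<open>Uniqueness of weight decompositions and the projections onto weight spaces\<close>

lemma direct_indep:
  assumes "finite J" "J \<subseteq> \<Lambda>" "f \<in> (\<Pi> w\<in>J. wt w)" "finsum A f J = \<zero>" "w \<in> J"
  shows "f w = \<zero>"
  using direct assms unfolding is_direct_sum_def by blast

text \<open>The direct sum condition speaks of vanishing sums only, so both families are padded to a
  common index set and subtracted. The index sets of two decompositions may differ by zero terms,
  hence the comparison of values extended by zero.\<close>

lemma decomposition_unique: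
  assumes J: "finite J" "J \<subseteq> \<Lambda>" "f \<in> (\<Pi> w\<in>J. wt w)"
    and K: "finite K" "K \<subseteq> \<Lambda>" "g \<in> (\<Pi> w\<in>K. wt w)"
    and eq: "finsum A f J = finsum A g K"
  shows "(if w \<in> J then f w else \<zero>) = (if w \<in> K then g w else \<zero>)"
proof (cases "w \<in> J \<union> K")
  case True
  let ?f = "\<lambda>w. if w \<in> J then f w else \<zero>" and ?g = "\<lambda>w. if w \<in> K then g w else \<zero>"
  have fc: "f v \<in> carrier A" if "v \<in> J" for v using J(3) that by (intro wt_carrier[of _ "ch v"]) blast
  have gc: "g v \<in> carrier A" if "v \<in> K" for v using K(3) that by (intro wt_carrier[of _ "ch v"]) blast
  have f: "f \<in> J \<rightarrow> carrier A" "?f \<in> J \<union> K \<rightarrow> carrier A" using fc by auto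
  have g: "g \<in> K \<rightarrow> carrier A" "?g \<in> J \<union> K \<rightarrow> carrier A" using gc by auto
  have "finsum A f J = finsum A ?f (J \<union> K)" "finsum A g K = finsum A ?g (J \<union> K)"
    using f(1) g(1) J(1) K(1) by (simp_all only: finsum_extend[of "J \<union> K"] finite_Un Un_upper1 Un_upper2)
  then have "finsum A ?g (J \<union> K) = finsum A ?f (J \<union> K)" using eq by argo
  moreover have "finsum A (\<lambda>w. ?f w \<oplus> (-1) \<odot> ?g w) (J \<union> K)
      = finsum A ?f (J \<union> K) \<oplus> finsum A (\<lambda>w. (-1) \<odot> ?g w) (J \<union> K)"
    using f g by (intro finsum_addf) auto
  moreover have "finsum A (\<lambda>w. (-1) \<odot> ?g w) (J \<union> K) = (-1) \<odot> finsum A ?g (J \<union> K)"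
    using finsum_hom_closed[OF abelian_monoid_axioms abelian_monoid_axioms, of "carrier A"
        "\<lambda>x. (-1) \<odot> x" ?g "J \<union> K"] g(2) by (auto simp: smult_add_right)
  ultimately have "finsum A (\<lambda>w. ?f w \<oplus> (-1) \<odot> ?g w) (J \<union> K) = \<zero>"
    using f(2) by (simp only: smult_minus_one finsum_closed r_neg)
  moreover have "?f v \<in> wt v" "?g v \<in> wt v" for v
    using J(3) K(3) csubspaceD(3)[OF csubspace_weight_space] by auto
  then have "(\<lambda>w. ?f w \<oplus> (-1) \<odot> ?g w) \<in> (\<Pi> w\<in>J \<union> K. wt w)"
    by (intro Pi_I csubspaceD(4,5)[OF csubspace_weight_space])
  ultimately have "?f w \<oplus> (-1) \<odot> ?g w = \<zero>"
    using direct_indep[of "J \<union> K" "\<lambda>w. ?f w \<oplus> (-1) \<odot> ?g w" w] J(1,2) K(1,2) True by simp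
  moreover have "?f w \<in> carrier A" "?g w \<in> carrier A" using f(2) g(2) True by blast+
  ultimately show ?thesis by (simp only: smult_minus_one r_right_minus_eq flip: a_minus_def)
qed simp

text \<open>The projection onto the weight space of \<open>w\<close>. The choice is made among
  values rather than among decompositions: the index set of a decomposition is not unique, but its
  value at \<open>w\<close> is. Outside \<open>\<Lambda>\<close> the value is zero.\<close>

definition component :: "'w \<Rightarrow> 'a \<Rightarrow> 'a" where
  "component w a = (SOME b. \<exists>J f. finite J \<and> J \<subseteq> \<Lambda> \<and> f \<in> (\<Pi> w\<in>J. wt w) \<and> a = finsum A f J
     \<and> b = (if w \<in> J then f w else \<zero>))"

lemma component_finsum:
  assumes "finite J" "J \<subseteq> \<Lambda>" "f \<in> (\<Pi> w\<in>J. wt w)"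
  shows "component w (finsum A f J) = (if w \<in> J then f w else \<zero>)"
  unfolding component_def
proof (rule someI2_ex)
  show "\<exists>b K g. finite K \<and> K \<subseteq> \<Lambda> \<and> g \<in> (\<Pi> w\<in>K. wt w) \<and> finsum A f J = finsum A g K
     \<and> b = (if w \<in> K then g w else \<zero>)"
    using assms by blast
next
  fix b
  assume "\<exists>K g. finite K \<and> K \<subseteq> \<Lambda> \<and> g \<in> (\<Pi> w\<in>K. wt w) \<and> finsum A f J = finsum A g K
     \<and> b = (if w \<in> K then g w else \<zero>)"
  then obtain K g where K: "finite K" "K \<subseteq> \<Lambda>" "g \<in> (\<Pi> w\<in>K. wt w)" "finsum A f J = finsum A g K"
    and b: "b = (if w \<in> K then g w else \<zero>)" by blast
  show "b = (if w \<in> J then f w else \<zero>)"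
    unfolding b by (rule decomposition_unique[OF assms K, symmetric])
qed

text \<open>Besides the index set \<open>J\<close>, every larger finite \<open>K\<close> inside
  \<open>\<Lambda>\<close> is offered, so that two elements can be summed over one index
  set.\<close>

lemma decomposition:
  assumes "a \<in> carrier A"
  obtains J where "finite J" "J \<subseteq> \<Lambda>" "\<And>w. w \<notin> J \<Longrightarrow> component w a = \<zero>" "\<And>w. component w a \<in> wt w"
    "\<And>K. finite K \<Longrightarrow> J \<subseteq> K \<Longrightarrow> K \<subseteq> \<Lambda> \<Longrightarrow> a = finsum A (\<lambda>w. component w a) K"
proof -
  obtain J f where J: "finite J" "J \<subseteq> \<Lambda>" "f \<in> (\<Pi> w\<in>J. wt w)" "a = finsum A f J"
    using assms direct unfolding is_direct_sum_def subspace_sum_def by blast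
  then have eq: "component w a = (if w \<in> J then f w else \<zero>)" for w using component_finsum by simp
  have f: "f \<in> J \<rightarrow> carrier A" using J(3) wt_carrier by blast
  show thesis
  proof (rule that[OF J(1,2)])
    show "component w a \<in> wt w" for w
      using J(3) csubspaceD(3)[OF csubspace_weight_space] by (auto simp: eq)
    show "a = finsum A (\<lambda>w. component w a) K" if "finite K" "J \<subseteq> K" "K \<subseteq> \<Lambda>" for K
      unfolding eq using finsum_extend[OF that(1,2) f] J(4) by simp
  qed (simp add: eq)
qed

lemma component_wt: "a \<in> carrier A \<Longrightarrow> component w a \<in> wt w"
  by (meson decomposition)

lemma component_closed [simp]: "a \<in> carrier A \<Longrightarrow> component w a \<in> carrier A"
  using component_wt wt_carrier by blast

lemma component_outside: "a \<in> carrier A \<Longrightarrow> w \<notin> \<Lambda> \<Longrightarrow> component w a = \<zero>"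
  by (meson decomposition subsetD)

lemma component_of_wt:
  assumes "v \<in> \<Lambda>" "a \<in> wt v"
  shows "component w a = (if w = v then a else \<zero>)"
proof -
  have "finsum A (\<lambda>_. a) {v} = a" using wt_carrier[OF assms(2)] by simp
  then show ?thesis using component_finsum[of "{v}" "\<lambda>_. a" w] assms by simp
qed

lemma component_add:
  assumes "a \<in> carrier A" "b \<in> carrier A"
  shows "component w (a \<oplus> b) = component w a \<oplus> component w b"
proof -
  obtain J where J: "finite J" "J \<subseteq> \<Lambda>" "\<And>w. w \<notin> J \<Longrightarrow> component w a = \<zero>"
    "\<And>K. finite K \<Longrightarrow> J \<subseteq> K \<Longrightarrow> K \<subseteq> \<Lambda> \<Longrightarrow> a = finsum A (\<lambda>w. component w a) K"
    using decomposition[OF assms(1)] by metis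
  obtain K where K: "finite K" "K \<subseteq> \<Lambda>" "\<And>w. w \<notin> K \<Longrightarrow> component w b = \<zero>"
    "\<And>J. finite J \<Longrightarrow> K \<subseteq> J \<Longrightarrow> J \<subseteq> \<Lambda> \<Longrightarrow> b = finsum A (\<lambda>w. component w b) J"
    using decomposition[OF assms(2)] by metis
  let ?L = "J \<union> K"
  have "a = finsum A (\<lambda>w. component w a) ?L" "b = finsum A (\<lambda>w. component w b) ?L"
    using J(1,2) K(1,2) by (auto intro!: J(4) K(4))
  then have "a \<oplus> b = finsum A (\<lambda>w. component w a) ?L \<oplus> finsum A (\<lambda>w. component w b) ?L" by (rule arg_cong2)
  also have "\<dots> = finsum A (\<lambda>w. component w a \<oplus> component w b) ?L"
    using assms by (intro finsum_addf[symmetric]) auto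
  finally have ab: "a \<oplus> b = finsum A (\<lambda>w. component w a \<oplus> component w b) ?L" .
  have "component w (a \<oplus> b) = (if w \<in> ?L then component w a \<oplus> component w b else \<zero>)"
    unfolding ab using J(1,2) K(1,2) component_wt[OF assms(1)] component_wt[OF assms(2)]
    by (intro component_finsum) (auto intro!: csubspaceD(4)[OF csubspace_weight_space])
  then show ?thesis using J(3) K(3) by auto
qed

text \<open>Replaces explicit finite sums of weight vectors. The predicate is only tested on
  components of the given \<open>a\<close>, so what is known about \<open>a\<close> can be used in
  that case.\<close>

lemma homogeneous_induct:
  assumes "a \<in> carrier A" "P \<zero>" "\<And>w. w \<in> \<Lambda> \<Longrightarrow> P (component w a)"
    "\<And>x y. x \<in> carrier A \<Longrightarrow> y \<in> carrier A \<Longrightarrow> P x \<Longrightarrow> P y \<Longrightarrow> P (x \<oplus> y)"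
  shows "P a"
proof -
  obtain J where J: "finite J" "J \<subseteq> \<Lambda>" "a = finsum A (\<lambda>w. component w a) J"
    using decomposition[OF assms(1)] by (metis order_refl)
  have "finsum A (\<lambda>w. component w a) J \<in> {x \<in> carrier A. P x}"
    using assms J(2) by (intro finsum_mem) auto
  then show ?thesis using J(3) by simp
qed

lemma component_zero [simp]: "component w \<zero> = \<zero>"
  using component_finsum[of "{}" "\<lambda>_. \<zero>" w] by simp

lemma component_act:
  assumes g: "g \<in> carrier G" and "a \<in> carrier A"
  shows "component w (\<rho> g a) = ch w g \<odot> component w a"
  using assms(2)
proof (rule homogeneous_induct)
  fix v assume v: "v \<in> \<Lambda>"
  let ?b = "component v a"
  have b: "?b \<in> wt v" "?b \<in> carrier A" using component_wt assms by auto
  then have eq: "\<rho> g ?b = ch v g \<odot> ?b" using g by (simp add: weight_space_def)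
  have "ch v g \<odot> ?b \<in> wt v" using b csubspaceD(5)[OF csubspace_weight_space] by blast
  then show "component w (\<rho> g ?b) = ch w g \<odot> component w ?b"
    unfolding eq using component_of_wt[OF v] b by simp
qed (use g in \<open>auto simp: act_add component_add smult_add_right\<close>)

lemma component_smult:
  assumes "a \<in> carrier A"
  shows "component w (c \<odot> a) = c \<odot> component w a"
  using assms
proof (rule homogeneous_induct)
  fix v assume v: "v \<in> \<Lambda>"
  have "c \<odot> component v a \<in> wt v" using component_wt[OF assms] csubspaceD(5)[OF csubspace_weight_space] by blast
  then show "component w (c \<odot> component v a) = c \<odot> component w (component v a)"
    using component_of_wt[OF v] component_wt[OF assms, of v] by simp
qed (auto simp: smult_add_right component_add)

lemma component_lincomb:
  assumes "x \<in> I \<rightarrow> carrier A"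
  shows "component w (lincomb c x I) = lincomb c (\<lambda>i. component w (x i)) I"
proof -
  have "component w (lincomb c x I) = finsum A (\<lambda>i. component w (c i \<odot> x i)) I"
    using finsum_hom_closed[OF abelian_monoid_axioms abelian_monoid_axioms, of "carrier A"
        "component w" "\<lambda>i. c i \<odot> x i" I] assms by (auto simp: component_add)
  also have "\<dots> = lincomb c (\<lambda>i. component w (x i)) I"
    using assms by (intro finsum_cong') (auto simp: component_smult Pi_iff)
  finally show ?thesis .
qed

text \<open>Acting by \<open>g\<close> scales the component both by \<open>ch w g\<close> and by
  \<open>\<chi> g\<close>. Here \<open>\<chi>\<close> is any function, so that the lemma covers
  products of two weights, which need not be indexed by \<open>\<Lambda>\<close>.\<close>

lemma component_weight_vector:
  assumes a: "a \<in> weight_space G A \<rho> \<chi>" and g: "g \<in> carrier G" "ch w g \<noteq> \<chi> g"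
  shows "component w a = \<zero>"
proof -
  have ac: "a \<in> carrier A" using a wt_carrier by blast
  have "ch w g \<odot> component w a = component w (\<rho> g a)" using component_act[OF g(1) ac] by simp
  also have "\<dots> = \<chi> g \<odot> component w a" using a g(1) ac by (simp add: weight_space_def component_smult)
  finally have "(ch w g - \<chi> g) \<odot> component w a = \<zero>"
    using smult_add_left[of "component w a" "ch w g" "- \<chi> g"] smult_add_left[of "component w a" "\<chi> g" "- \<chi> g"] ac
    by simp
  then show ?thesis using smult_cancel[of "component w a"] ac g(2) by simp
qed

lemma component_weight_vector':
  assumes a: "a \<in> weight_space G A \<rho> \<chi>" and w: "w \<in> \<Lambda>" "\<And>g. g \<in> carrier G \<Longrightarrow> ch w g = \<chi> g"
  shows "component w a = a"
proof -
  have "a \<in> wt w" using a w(2) by (auto simp: weight_space_def)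
  then show ?thesis using component_of_wt[OF w(1)] by simp
qed

text \<open>By bilinearity only products of a component of \<open>a\<close> with a component of
  \<open>b\<close> matter, and such a product contributes to weight \<open>w\<close> only if the two
  weights multiply to it. Membership in a subspace \<open>N\<close> stands in for a convolution
  formula; the zero subspace turns it into a vanishing statement.\<close>

lemma component_mult_mem:
  assumes ab: "a \<in> carrier A" "b \<in> carrier A" and w: "w \<in> \<Lambda>" and N: "csubspace N"
    and prod: "\<And>u v. u \<in> \<Lambda> \<Longrightarrow> v \<in> \<Lambda> \<Longrightarrow> \<forall>g\<in>carrier G. ch w g = ch u g * ch v g \<Longrightarrow>
      component u a \<otimes> component v b \<in> N"
  shows "component w (a \<otimes> b) \<in> N"
  using ab(1)
proof (rule homogeneous_induct)
  fix u assume u: "u \<in> \<Lambda>"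
  show "component w (component u a \<otimes> b) \<in> N"
    using ab(2)
  proof (rule homogeneous_induct)
    fix v assume v: "v \<in> \<Lambda>"
    have "component u a \<otimes> component v b \<in> weight_space G A \<rho> (\<lambda>g. ch u g * ch v g)"
      using component_wt[OF ab(1), of u] component_wt[OF ab(2), of v]
      by (auto simp: weight_space_def act_mult smult_mult_left smult_mult_right smult_smult mult.commute)
    note wv = component_weight_vector[OF this] component_weight_vector'[OF this w]
    show "component w (component u a \<otimes> component v b) \<in> N"
    proof (cases "\<forall>g\<in>carrier G. ch w g = ch u g * ch v g")
      case True
      then show ?thesis using wv(2) prod[OF u v] by simp
    next
      case False
      then show ?thesis using wv(1) csubspaceD(3)[OF N] by auto
    qed
  qed (use ab csubspaceD(3,4)[OF N] in \<open>auto simp: r_distr component_add\<close>)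
qed (use ab csubspaceD(3,4)[OF N] in \<open>auto simp: l_distr component_add\<close>)

text \<open>Subtracting the component at \<open>v\<close> leaves zero at \<open>v\<close> and
  changes nothing elsewhere, so all components of the difference lie in \<open>N\<close>. The index
  \<open>v\<close> may lie outside \<open>\<Lambda>\<close>.\<close>

lemma diff_component_mem:
  assumes "y \<in> carrier A" "csubspace N" "\<And>w. w \<in> \<Lambda> \<Longrightarrow> w \<noteq> v \<Longrightarrow> component w y \<in> N"
  shows "y \<ominus> component v y \<in> N"
proof -
  have "component w (y \<ominus> component v y) \<in> N" if w: "w \<in> \<Lambda>" for w
  proof -
    have "component w (y \<ominus> component v y) = component w y \<ominus> component w (component v y)"
      using assms(1) by (simp add: minus_eq_smult component_add component_smult)
    moreover have "component w (component v y) = (if w = v then component v y else \<zero>)"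
      using component_of_wt[of v "component v y" w] component_wt[OF assms(1)] component_outside[OF assms(1)]
      by (cases "v \<in> \<Lambda>") auto
    ultimately show ?thesis
      using assms w csubspaceD(3)[OF assms(2)] by (auto simp: a_minus_def r_neg)
  qed
  moreover have "y \<ominus> component v y \<in> carrier A" using assms(1) by simp
  ultimately show ?thesis
    using csubspaceD(3,4)[OF assms(2)] by (rule_tac homogeneous_induct[of _ "\<lambda>z. z \<in> N"]) auto
qed

text \<open>The component at \<open>w\<close> of \<open>\<rho> g y \<ominus> c \<odot> y\<close> is
  \<open>ch w g - c\<close> times that of \<open>y\<close>, and this scalar is invertible. This is
  how weights in a quotient by \<open>N\<close> give information about components in the
  algebra.\<close>

lemma component_mem_of_weight_mod:
  assumes y: "y \<in> carrier A" and N: "csubspace N" "\<And>z. z \<in> N \<Longrightarrow> component w z \<in> N"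
    and g: "g \<in> carrier G" "\<rho> g y \<ominus> c \<odot> y \<in> N" "ch w g \<noteq> c"
  shows "component w y \<in> N"
proof -
  have "component w (\<rho> g y \<ominus> c \<odot> y) = (ch w g - c) \<odot> component w y"
    using y g(1) smult_add_left[of "component w y" "ch w g" "- c"]
    by (simp add: minus_eq_smult component_add component_smult component_act smult_smult)
  then have "(ch w g - c) \<odot> component w y \<in> N" using N(2)[OF g(2)] by simp
  then have "inverse (ch w g - c) \<odot> ((ch w g - c) \<odot> component w y) \<in> N" by (rule csubspaceD(5)[OF N(1)])
  then show ?thesis using y g(3) by (simp add: smult_smult)
qed

end

section \<open>Non-negatively graded algebras with constant degree zero part\<close>

lemma carrier_Gm: "carrier Gm = - {0}"
  by (simp add: Gm_def)

lemma carrier_with_rot: "carrier (with_rot T) = carrier T \<times> - {0}"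
  by (simp add: affine_prod_def monoid.defs DirProd_def carrier_Gm)

text \<open>Regular functions on a torus are pulled back from a power of the multiplicative group by
  restricted functions, hence are extensional and determined by their values on the carrier.\<close>

lemma torus_character_ext:
  assumes "algebraic_torus T" "\<chi> \<in> characters T" "\<psi> \<in> characters T"
    "\<And>t. t \<in> carrier T \<Longrightarrow> \<chi> t = \<psi> t"
  shows "\<chi> = \<psi>"
proof -
  have "regular T \<subseteq> extensional (carrier T)"
    using assms(1) unfolding algebraic_torus_def affine_group_iso_def by force
  then show ?thesis
    using assms by (intro extensionalityI[of \<chi> "carrier T"]) (auto simp: characters_def)
qed

lemma trivial_char_iff:
  assumes "algebraic_torus T" "\<chi> \<in> characters T"
  shows "\<chi> = trivial_char T \<longleftrightarrow> (\<forall>t\<in>carrier T. \<chi> t = 1)"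
proof -
  have "regular T \<subseteq> extensional (carrier T)"
    using assms(1) unfolding algebraic_torus_def affine_group_iso_def by force
  then have "\<chi> \<in> extensional (carrier T)" using assms(2) by (auto simp: characters_def)
  then show ?thesis
    unfolding trivial_char_def by (auto intro: extensionalityI)
qed

lemma character_one:
  assumes "group T" "\<chi> \<in> characters T"
  shows "\<chi> \<one>\<^bsub>T\<^esub> = 1"
proof -
  interpret group T by fact
  have \<chi>: "\<chi> \<in> hom T Gm" using assms(2) by (simp add: characters_def)
  have "\<chi> \<one>\<^bsub>T\<^esub> \<noteq> 0" using hom_in_carrier[OF \<chi> one_closed] by (simp add: carrier_Gm)
  moreover have "\<chi> \<one>\<^bsub>T\<^esub> * \<chi> \<one>\<^bsub>T\<^esub> = \<chi> \<one>\<^bsub>T\<^esub>"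
    using hom_mult[OF \<chi> one_closed one_closed] by (simp add: Gm_def)
  ultimately show ?thesis by simp
qed

text \<open>The number 2 is not a root of unity, so the single point \<open>z = 2\<close> of the
  rotation group already tells all degrees apart. The norm moves the question to the reals, where
  powers of 2 increase strictly.\<close>

lemma two_powi_inject: "(2::complex) powi k = 2 powi l \<Longrightarrow> k = l"
proof (rule ccontr)
  assume eq: "(2::complex) powi k = 2 powi l" and "k \<noteq> l"
  have "(2::real) powi k = 2 powi l" using arg_cong[OF eq, of norm] by (simp add: norm_power_int)
  with \<open>k \<noteq> l\<close> show False
    using power_int_strict_increasing[of k l "2::real"] power_int_strict_increasing[of l k "2::real"]
    by linarith
qed

text \<open>The bijection in \<open>rot_invariants\<close> says that the invariants are exactly the
  constants: every invariant is a multiple of one, and distinct scalars give distinct elements, so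
  the algebra is not zero.\<close>

locale rot_graded_algebra =
  fixes T :: "'t affine_group"
    and A :: "(complex, 'a) module" (structure)
    and \<rho> :: "'t \<times> complex \<Rightarrow> 'a \<Rightarrow> 'a"
  assumes torus: "algebraic_torus T"
    and is_algebra: "algebra (ring_of_type_algebra :: complex ring) A"
    and is_action: "algebraic_action (with_rot T) A \<rho>"
    and grading: "is_direct_sum A (characters T \<times> {k::int. k \<ge> 0})
                    (\<lambda>(\<chi>, k). weight_space (with_rot T) A \<rho> (char_plus \<chi> k))"
    and rot_invariants: "bij_betw (\<lambda>c. c \<odot>\<^bsub>A\<^esub> \<one>\<^bsub>A\<^esub>) UNIV
                    {a \<in> carrier A. \<forall>z\<in>carrier Gm. rot_action T \<rho> z a = a}"
begin

lemma group_T: "group T"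
  using torus by (simp add: algebraic_torus_def)

lemma one_T: "\<one>\<^bsub>T\<^esub> \<in> carrier T"
  using group_T by (simp add: group.is_monoid monoid.one_closed)

text \<open>Degrees are read off at the point with torus part one and rotation part 2, characters at
  the points \<open>(t, 1)\<close>.\<close>

lemma weights_mult:
  assumes "\<chi> \<in> characters T" "\<chi>1 \<in> characters T" "\<chi>2 \<in> characters T"
    "\<forall>g\<in>carrier (with_rot T). char_plus \<chi> k g = char_plus \<chi>1 k1 g * char_plus \<chi>2 k2 g"
  shows "k = k1 + k2" "\<And>t. t \<in> carrier T \<Longrightarrow> \<chi> t = \<chi>1 t * \<chi>2 t"
proof -
  have *: "\<chi> t * z powi k = (\<chi>1 t * z powi k1) * (\<chi>2 t * z powi k2)" if "t \<in> carrier T" "z \<noteq> 0" for t z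
    using assms(4) that by (auto simp: carrier_with_rot char_plus_def)
  have "(2::complex) powi k = 2 powi k1 * 2 powi k2"
    using *[OF one_T, of 2] assms(1-3)[THEN character_one[OF group_T]] by simp
  then show "k = k1 + k2" by (intro two_powi_inject) (simp add: power_int_add)
  show "\<chi> t = \<chi>1 t * \<chi>2 t" if "t \<in> carrier T" for t using *[OF that, of 1] by simp
qed

lemma weights_separated:
  assumes "\<chi> \<in> characters T" "\<psi> \<in> characters T" "(\<chi>, k) \<noteq> (\<psi>, l)"
  shows "\<exists>g\<in>carrier (with_rot T). char_plus \<chi> k g \<noteq> char_plus \<psi> l g"
proof (rule ccontr)
  assume "\<not> ?thesis"
  then have *: "\<chi> t * z powi k = \<psi> t * z powi l" if "t \<in> carrier T" "z \<noteq> 0" for t z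
    using that by (auto simp: carrier_with_rot char_plus_def)
  have "k = l"
    using *[OF one_T, of 2] assms(1,2)[THEN character_one[OF group_T]] by (intro two_powi_inject) simp
  moreover have "\<chi> = \<psi>"
    using *[of _ 1] by (intro torus_character_ext[OF torus assms(1,2)]) simp
  ultimately show False using assms(3) by simp
qed

abbreviation "weights \<equiv> characters T \<times> {k::int. k \<ge> 0}"

sublocale weighted_algebra "with_rot T" A \<rho> weights "\<lambda>(\<chi>, k). char_plus \<chi> k"
proof (rule weighted_algebra.intro)
  show "is_direct_sum A weights
     (\<lambda>w. weight_space (with_rot T) A \<rho> (case w of (\<chi>, k) \<Rightarrow> char_plus \<chi> k))"
    using grading by (simp add: case_prod_beta')
  show "\<exists>g\<in>carrier (with_rot T). (case v of (\<chi>, k) \<Rightarrow> char_plus \<chi> k) g \<noteq> (case w of (\<chi>, k) \<Rightarrow> char_plus \<chi> k) g"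
    if "v \<in> weights" "w \<in> weights" "v \<noteq> w" for v w
    using that weights_separated by (cases v; cases w) auto
qed (rule is_algebra is_action)+

section \<open>The maximal ideal and its square in terms of components\<close>

abbreviation "\<mm> \<equiv> maximal_ideal_rot T A \<rho>"
abbreviation "\<mm>2 \<equiv> maximal_ideal_sq T A \<rho>"

text \<open>On the rotation subgroup the weight takes the value
  \<open>\<chi> \<one> * z powi 0\<close>, which is 1, so the vector is invariant.\<close>

lemma component_degree_zero:
  assumes "a \<in> wt (\<chi>, 0)" "\<chi> \<in> characters T"
  shows "\<exists>c. a = c \<odot> \<one>"
proof -
  have "rot_action T \<rho> z a = a" if "z \<in> carrier Gm" for z
    using assms that one_T character_one[OF group_T assms(2)]
    by (auto simp: weight_space_def rot_action_def carrier_with_rot char_plus_def carrier_Gm)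
  then have "a \<in> {a \<in> carrier A. \<forall>z\<in>carrier Gm. rot_action T \<rho> z a = a}"
    using wt_carrier[OF assms(1)] by simp
  then show ?thesis using rot_invariants unfolding bij_betw_def by blast
qed

text \<open>A constant is fixed by T, while a nontrivial character moves every nonzero vector of its
  weight space.\<close>

lemma wt_degree_zero:
  assumes a: "a \<in> wt (\<chi>, 0)" and \<chi>: "\<chi> \<in> characters T" "\<chi> \<noteq> trivial_char T"
  shows "a = \<zero>"
proof -
  obtain t where t: "t \<in> carrier T" "\<chi> t \<noteq> 1" using trivial_char_iff[OF torus \<chi>(1)] \<chi>(2) by auto
  then have g: "(t, 1) \<in> carrier (with_rot T)" by (simp add: carrier_with_rot)
  obtain c where c: "a = c \<odot> \<one>" using component_degree_zero[OF a \<chi>(1)] by blast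
  have "\<rho> (t, 1) a = a" using g by (simp add: c act_smult act_one)
  moreover have "\<rho> (t, 1) a = \<chi> t \<odot> a" using a g by (simp add: weight_space_def char_plus_def)
  ultimately have "(\<chi> t + - 1) \<odot> a = \<zero>"
    using wt_carrier[OF a] smult_add_left[of a "\<chi> t" "- 1"] by (simp add: smult_minus_one r_neg)
  then show ?thesis using smult_cancel[OF wt_carrier[OF a]] t(2) by simp
qed

lemma csubspace_component_kernel: "csubspace {a \<in> carrier A. \<forall>w\<in>S. component w a = \<zero>}"
  by (rule csubspaceI) (auto simp: component_add component_smult)

text \<open>Trades the description as a sum of weight spaces for the vanishing of linear maps, from
  which closure properties and stability under the action follow by simplification.\<close>

lemma max_ideal_iff: "a \<in> \<mm> \<longleftrightarrow> a \<in> carrier A \<and> (\<forall>\<chi>\<in>characters T. component (\<chi>, 0) a = \<zero>)"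
proof -
  let ?U = "{a \<in> carrier A. \<forall>w\<in>characters T \<times> {0}. component w a = \<zero>}"
  have "\<mm> \<subseteq> ?U"
    unfolding maximal_ideal_rot_def
  proof (rule subspace_sum_least[OF csubspace_component_kernel], safe)
    fix \<chi> k x assume k: "\<chi> \<in> characters T" "(k::int) > 0"
      and x: "x \<in> weight_space (with_rot T) A \<rho> (char_plus \<chi> k)"
    then show "x \<in> carrier A" using wt_carrier by blast
    show "component (\<psi>, 0) x = \<zero>" if "\<psi> \<in> characters T" for \<psi>
      using component_of_wt[of "(\<chi>, k)" x] k x by simp
  qed
  moreover have "a \<in> \<mm>" if a: "a \<in> ?U" for a
  proof -
    have sub: "csubspace \<mm>"
      unfolding maximal_ideal_rot_def
      by (rule csubspace_subspace_sum) (auto simp: csubspace_weight_space)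
    have ac: "a \<in> carrier A" using a by simp
    then show ?thesis
    proof (rule homogeneous_induct)
      fix w assume w: "w \<in> weights"
      obtain \<chi> k where [simp]: "w = (\<chi>, k)" by (cases w)
      show "component w a \<in> \<mm>"
      proof (cases "k = 0")
        case True
        then show ?thesis using a w csubspaceD(3)[OF sub] by auto
      next
        case False
        then show ?thesis
          unfolding maximal_ideal_rot_def using w component_wt[OF ac, of w] ac
          by (intro subspace_sum_mem[of w]) auto
      qed
    qed (use csubspaceD(3,4)[OF sub] in auto)
  qed
  ultimately show ?thesis by auto
qed

lemma max_ideal_carrier: "a \<in> \<mm> \<Longrightarrow> a \<in> carrier A"
  by (simp add: max_ideal_iff)

lemma csubspace_max_ideal: "csubspace \<mm>"
  by (rule csubspaceI) (auto simp: max_ideal_iff component_add component_smult)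

lemma wt_max_ideal: "\<chi> \<in> characters T \<Longrightarrow> k > 0 \<Longrightarrow> a \<in> wt (\<chi>, k) \<Longrightarrow> a \<in> \<mm>"
  using component_of_wt[of "(\<chi>, k)" a] wt_carrier by (auto simp: max_ideal_iff)

lemma component_max_ideal:
  assumes "a \<in> \<mm>"
  shows "component w a \<in> \<mm>"
proof (cases "w \<in> weights")
  case True
  then show ?thesis
    using assms component_of_wt[OF True component_wt[OF max_ideal_carrier[OF assms]]]
    by (auto simp: max_ideal_iff)
next
  case False
  then show ?thesis
    using component_outside[OF max_ideal_carrier[OF assms]] csubspaceD(3)[OF csubspace_max_ideal] by simp
qed

text \<open>Two nonnegative degrees with sum zero are both zero, and the factor \<open>x\<close> has
  no component of degree zero. Hence the product has none either.\<close>

lemma ideal_max_ideal: "ideal \<mm> A"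
proof (rule csubspace_ideal[OF csubspace_max_ideal])
  fix a x assume a: "a \<in> carrier A" and x: "x \<in> \<mm>"
  have xc: "x \<in> carrier A" using x by (rule max_ideal_carrier)
  have "component (\<chi>, 0) (a \<otimes> x) \<in> {\<zero>}" if \<chi>: "\<chi> \<in> characters T" for \<chi>
  proof (rule component_mult_mem[OF a xc])
    show "csubspace {\<zero>}" by (rule csubspaceI) auto
    fix u v assume u: "u \<in> weights" and v: "v \<in> weights"
      and eq: "\<forall>g\<in>carrier (with_rot T). (case (\<chi>, 0) of (\<chi>, k) \<Rightarrow> char_plus \<chi> k) g =
        (case u of (\<chi>, k) \<Rightarrow> char_plus \<chi> k) g * (case v of (\<chi>, k) \<Rightarrow> char_plus \<chi> k) g"
    obtain \<chi>1 k1 \<chi>2 k2 where uv: "u = (\<chi>1, k1)" "v = (\<chi>2, k2)" by (cases u; cases v)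
    then have "k2 = 0" using weights_mult(1)[of \<chi> \<chi>1 \<chi>2 0 k1 k2] eq \<chi> u v by auto
    then show "component u a \<otimes> component v x \<in> {\<zero>}" using x uv v a by (auto simp: max_ideal_iff)
  qed (use \<chi> in auto)
  then show "a \<otimes> x \<in> \<mm>" using a xc by (simp add: max_ideal_iff)
qed

lemma constant_plus_max_ideal:
  assumes "a \<in> carrier A"
  shows "\<exists>c. a \<ominus> c \<odot> \<one> \<in> \<mm>"
  using assms
proof (rule homogeneous_induct)
  show "\<exists>c. \<zero> \<ominus> c \<odot> \<one> \<in> \<mm>"
    using csubspaceD(3)[OF csubspace_max_ideal] by (intro exI[of _ 0]) (simp add: minus_eq_smult)
  fix w assume w: "w \<in> weights"
  obtain \<chi> k where [simp]: "w = (\<chi>, k)" by (cases w)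
  show "\<exists>c. component w a \<ominus> c \<odot> \<one> \<in> \<mm>"
  proof (cases "k = 0")
    case True
    then obtain c where "component w a = c \<odot> \<one>"
      using component_degree_zero[of "component w a" \<chi>] component_wt[OF assms, of w] w by auto
    then have "component w a \<ominus> c \<odot> \<one> = \<zero>" by simp
    then show ?thesis using csubspaceD(3)[OF csubspace_max_ideal] by metis
  next
    case False
    then have "component w a \<in> \<mm>" using wt_max_ideal[of \<chi> k] component_wt[OF assms, of w] w by auto
    then show ?thesis using assms by (intro exI[of _ 0]) (simp add: minus_eq_smult)
  qed
next
  fix x y assume xy: "x \<in> carrier A" "y \<in> carrier A"
    and "\<exists>c. x \<ominus> c \<odot> \<one> \<in> \<mm>" "\<exists>c. y \<ominus> c \<odot> \<one> \<in> \<mm>"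
  then obtain c d where "x \<ominus> c \<odot> \<one> \<in> \<mm>" "y \<ominus> d \<odot> \<one> \<in> \<mm>" by blast
  then have "(x \<ominus> c \<odot> \<one>) \<oplus> (y \<ominus> d \<odot> \<one>) \<in> \<mm>" by (rule csubspaceD(4)[OF csubspace_max_ideal])
  moreover have "(x \<ominus> c \<odot> \<one>) \<oplus> (y \<ominus> d \<odot> \<one>) = (x \<oplus> y) \<ominus> (c + d) \<odot> \<one>"
    using xy by (simp add: minus_eq minus_add a_ac smult_add_left)
  ultimately show "\<exists>c. x \<oplus> y \<ominus> c \<odot> \<one> \<in> \<mm>" by metis
qed

lemma ideal_max_sq: "ideal \<mm>2 A"
  unfolding maximal_ideal_sq_def by (rule ideal_prod_is_ideal[OF ideal_max_ideal ideal_max_ideal])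

lemma csubspace_max_sq: "csubspace \<mm>2"
  by (rule ideal_csubspace[OF ideal_max_sq])

lemma max_sq_subset: "\<mm>2 \<subseteq> \<mm>"
  unfolding maximal_ideal_sq_def using ideal_prod_inter[OF ideal_max_ideal ideal_max_ideal] by blast

lemma max_sq_carrier: "a \<in> \<mm>2 \<Longrightarrow> a \<in> carrier A"
  using max_sq_subset max_ideal_carrier by blast

lemma mult_max_sq: "a \<in> \<mm> \<Longrightarrow> b \<in> \<mm> \<Longrightarrow> a \<otimes> b \<in> \<mm>2"
  unfolding maximal_ideal_sq_def by (rule ideal_prod.prod)

text \<open>A homogeneous component of an element of the square is a sum of products of weight
  vectors whose degrees are positive and add to \<open>k\<close>. With \<open>N\<close> the square
  itself this shows that the square is homogeneous; with \<open>N\<close> the ideal of the lifts it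
  is the induction step for generation.\<close>

lemma component_max_sq_mem:
  assumes z: "z \<in> \<mm>2" and \<chi>: "\<chi> \<in> characters T" "k \<ge> 0" and N: "csubspace N"
    and prod: "\<And>\<chi>1 k1 \<chi>2 k2 b c. \<chi>1 \<in> characters T \<Longrightarrow> \<chi>2 \<in> characters T \<Longrightarrow> k1 > 0 \<Longrightarrow> k2 > 0 \<Longrightarrow>
      k = k1 + k2 \<Longrightarrow> (\<And>t. t \<in> carrier T \<Longrightarrow> \<chi> t = \<chi>1 t * \<chi>2 t) \<Longrightarrow>
      b \<in> wt (\<chi>1, k1) \<Longrightarrow> c \<in> wt (\<chi>2, k2) \<Longrightarrow> b \<otimes> c \<in> N"
  shows "component (\<chi>, k) z \<in> N"
  using z unfolding maximal_ideal_sq_def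
proof (induction z rule: ideal_prod.induct)
  case (prod b c)
  then have bc: "b \<in> carrier A" "c \<in> carrier A" using max_ideal_carrier by auto
  show ?case
  proof (rule component_mult_mem[OF bc _ N])
    fix u v assume u: "u \<in> weights" and v: "v \<in> weights"
      and eq: "\<forall>g\<in>carrier (with_rot T). (case (\<chi>, k) of (\<chi>, k) \<Rightarrow> char_plus \<chi> k) g =
        (case u of (\<chi>, k) \<Rightarrow> char_plus \<chi> k) g * (case v of (\<chi>, k) \<Rightarrow> char_plus \<chi> k) g"
    obtain \<chi>1 k1 \<chi>2 k2 where uv: "u = (\<chi>1, k1)" "v = (\<chi>2, k2)" by (cases u; cases v)
    show "component u b \<otimes> component v c \<in> N"
    proof (cases "k1 > 0 \<and> k2 > 0")
      case True
      have eq': "\<forall>g\<in>carrier (with_rot T). char_plus \<chi> k g = char_plus \<chi>1 k1 g * char_plus \<chi>2 k2 g"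
        using eq uv by simp
      have "\<chi>1 \<in> characters T" "\<chi>2 \<in> characters T" using u v uv by auto
      with True show ?thesis
        using weights_mult[OF \<chi>(1) _ _ eq'] component_wt[OF bc(1), of u] component_wt[OF bc(2), of v] uv
        by (intro assms(5)[of \<chi>1 \<chi>2 k1 k2]) auto
    next
      case False
      \<comment> \<open>A degree that is not positive is zero here, and elements of the maximal
        ideal have no component in degree zero.\<close>
      then have "component u b = \<zero> \<or> component v c = \<zero>"
        using prod u v uv by (auto simp: max_ideal_iff)
      then show ?thesis using bc csubspaceD(3)[OF N] by auto
    qed
  qed (use \<chi> in auto)
next
  case (sum s t)
  have "s \<in> carrier A" "t \<in> carrier A"
    using sum.hyps max_sq_carrier unfolding maximal_ideal_sq_def by auto
  then show ?case using sum.IH csubspaceD(4)[OF N] by (simp add: component_add)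
qed

lemma component_max_sq:
  assumes "z \<in> \<mm>2"
  shows "component w z \<in> \<mm>2"
proof (cases "w \<in> weights")
  case True
  then show ?thesis
    using component_max_sq_mem[OF assms, of "fst w" "snd w" \<mm>2] csubspace_max_sq wt_max_ideal mult_max_sq
    by (cases w) auto
next
  case False
  then show ?thesis
    using component_outside[OF max_sq_carrier[OF assms]] csubspaceD(3)[OF csubspace_max_sq] by simp
qed

lemma act_max_ideal: "g \<in> carrier (with_rot T) \<Longrightarrow> a \<in> \<mm> \<Longrightarrow> \<rho> g a \<in> \<mm>"
  by (simp add: max_ideal_iff component_act)

lemma act_max_sq:
  assumes g: "g \<in> carrier (with_rot T)" and "a \<in> \<mm>2"
  shows "\<rho> g a \<in> \<mm>2"
  using assms(2) unfolding maximal_ideal_sq_def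
proof (induction a rule: ideal_prod.induct)
  case (prod b c)
  then show ?case using g act_max_ideal[OF g] max_ideal_carrier
    by (simp add: act_mult ideal_prod.prod)
next
  case (sum s t)
  then have "s \<in> carrier A" "t \<in> carrier A"
    using max_sq_carrier unfolding maximal_ideal_sq_def by auto
  then show ?case using g sum.IH by (simp add: act_add ideal_prod.sum)
qed

end

section \<open>The cotangent space and the fixed ideal\<close>

lemma char_plus_T [simp]: "char_plus \<chi> k (t, 1) = \<chi> t"
  by (simp add: char_plus_def)

lemma (in abelian_group) diff_add_diff:
  "\<lbrakk>a \<in> carrier G; b \<in> carrier G; c \<in> carrier G; d \<in> carrier G\<rbrakk> \<Longrightarrow>
    (a \<ominus> b) \<oplus> (c \<ominus> d) = (a \<oplus> c) \<ominus> (b \<oplus> d)"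
  by (simp add: a_minus_def minus_add a_ac)

lemma (in complex_module) smult_diff:
  "x \<in> carrier M \<Longrightarrow> y \<in> carrier M \<Longrightarrow> c \<odot> (x \<ominus> y) = c \<odot> x \<ominus> c \<odot> y"
  by (simp add: minus_eq_smult smult_add_right smult_smult)

lemma (in weighted_algebra) component_component:
  "a \<in> carrier A \<Longrightarrow> component w (component w a) = component w a"
  using component_of_wt[of w "component w a" w] component_wt[of a w] component_outside[of a w]
  by (cases "w \<in> \<Lambda>") auto

lemma (in weighted_algebra) component_diff:
  "a \<in> carrier A \<Longrightarrow> b \<in> carrier A \<Longrightarrow> component w (a \<ominus> b) = component w a \<ominus> component w b"
  by (simp add: minus_eq_smult component_add component_smult)

text \<open>The rewrite states all facts about the quotient in terms of \<open>cotangent\<close>,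
  the form in which the definitions built on it use it.\<close>

sublocale rot_graded_algebra \<subseteq> cot: complex_module_quotient A \<mm> \<mm>2
  rewrites "quotient_space A \<mm> \<mm>2 = cotangent T A \<rho>"
  by (intro complex_module_quotient.intro complex_module_axioms complex_module_quotient_axioms.intro
      csubspace_max_ideal csubspace_max_sq max_sq_subset) (simp add: cotangent_def)

context rot_graded_algebra
begin

section \<open>Weights of cotangent classes and their representatives\<close>

abbreviation "cot_space \<equiv> cotangent T A \<rho>"
abbreviation "nontriv \<equiv> nontrivial_part T cot_space (induced_action \<rho>)"
abbreviation "coset y \<equiv> \<mm>2 +> y"

lemma mem_coset_iff: "z \<in> coset y \<longleftrightarrow> (\<exists>h\<in>\<mm>2. z = h \<oplus> y)"
  by (simp add: a_r_coset_def')

text \<open>The action on cosets is taking images. That the image fills the whole coset uses that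
  the inverse group element preserves the square as well.\<close>

lemma induced_action_coset:
  assumes g: "g \<in> carrier (with_rot T)" and y: "y \<in> carrier A"
  shows "induced_action \<rho> g (coset y) = coset (\<rho> g y)"
proof (intro subset_antisym subsetI)
  fix z assume "z \<in> induced_action \<rho> g (coset y)"
  then obtain h where h: "h \<in> \<mm>2" "z = \<rho> g (h \<oplus> y)"
    unfolding induced_action_def by (auto simp only: mem_coset_iff image_iff)
  then have "z = \<rho> g h \<oplus> \<rho> g y" using act_add[OF g max_sq_carrier[OF h(1)] y] by simp
  then show "z \<in> coset (\<rho> g y)" unfolding mem_coset_iff by (rule bexI[OF _ act_max_sq[OF g h(1)]])
next
  fix z assume "z \<in> coset (\<rho> g y)"
  then obtain h where h: "h \<in> \<mm>2" "z = h \<oplus> \<rho> g y" by (auto simp only: mem_coset_iff)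
  let ?h = "\<rho> (inv\<^bsub>with_rot T\<^esub> g) h"
  have h': "?h \<in> \<mm>2" by (rule act_max_sq[OF group.inv_closed[OF group_G g] h(1)])
  then have "z = \<rho> g (?h \<oplus> y)"
    using h(2) act_add[OF g max_sq_carrier[OF h'] y] act_inv[OF g max_sq_carrier[OF h(1)]] by simp
  moreover have "?h \<oplus> y \<in> coset y" unfolding mem_coset_iff by (rule bexI[OF refl h'])
  ultimately show "z \<in> induced_action \<rho> g (coset y)"
    unfolding induced_action_def by (rule image_eqI)
qed

lemma coset_weight_iff:
  assumes g: "g \<in> carrier (with_rot T)" and y: "y \<in> \<mm>"
  shows "induced_action \<rho> g (coset y) = c \<odot>\<^bsub>cot_space\<^esub> (coset y) \<longleftrightarrow> \<rho> g y \<ominus> c \<odot> y \<in> \<mm>2"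
  using assms max_ideal_carrier[OF y]
  by (simp add: induced_action_coset cot.smult_Q cot.coset_eq_iff)

text \<open>A linear condition, checked on representatives: each coset in the weight space comes
  from some \<open>y\<close> that is an eigenvector modulo the square for all
  \<open>(t, 1)\<close>.\<close>

lemma csubspace_T_weight_space:
  "cot.Q.csubspace (weight_space T cot_space (T_action (induced_action \<rho>)) \<chi>)"
proof (rule cot.Q.csubspaceI)
  let ?S = "weight_space T cot_space (T_action (induced_action \<rho>)) \<chi>"
  have iff: "coset y \<in> ?S \<longleftrightarrow> (\<forall>t\<in>carrier T. \<rho> (t, 1) y \<ominus> \<chi> t \<odot> y \<in> \<mm>2)" if "y \<in> \<mm>" for y
    using that by (auto simp: weight_space_def T_action_def coset_weight_iff carrier_with_rot cot.carrier_Q)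
  have rep: "\<exists>y\<in>\<mm>. C = coset y" if "C \<in> ?S" for C
    using that by (auto simp: weight_space_def cot.carrier_Q)
  have g: "(t, 1) \<in> carrier (with_rot T)" if "t \<in> carrier T" for t
    using that by (simp add: carrier_with_rot)
  show "?S \<subseteq> carrier cot_space" by (auto simp: weight_space_def)
  show "\<zero>\<^bsub>cot_space\<^esub> \<in> ?S"
    unfolding cot.zero_Q_coset using csubspaceD(3)[OF csubspace_max_ideal] g csubspaceD(3)[OF csubspace_max_sq]
    by (subst iff) (auto simp: minus_eq_smult)
  show "C \<oplus>\<^bsub>cot_space\<^esub> D \<in> ?S" if C: "C \<in> ?S" and D: "D \<in> ?S" for C D
  proof -
    obtain x y where xy: "x \<in> \<mm>" "C = coset x" "y \<in> \<mm>" "D = coset y" using rep C D by metis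
    have xyc: "x \<in> carrier A" "y \<in> carrier A" using xy max_ideal_carrier by auto
    have "\<rho> (t, 1) (x \<oplus> y) \<ominus> \<chi> t \<odot> (x \<oplus> y) \<in> \<mm>2" if t: "t \<in> carrier T" for t
    proof -
      have "(\<rho> (t, 1) x \<ominus> \<chi> t \<odot> x) \<oplus> (\<rho> (t, 1) y \<ominus> \<chi> t \<odot> y) \<in> \<mm>2"
        using C D iff xy t by (intro csubspaceD(4)[OF csubspace_max_sq]) auto
      then show ?thesis using xyc g[OF t] by (simp add: diff_add_diff act_add smult_add_right)
    qed
    then show ?thesis
      using iff[of "x \<oplus> y"] csubspaceD(4)[OF csubspace_max_ideal] xy xyc by (simp add: cot.add_Q)
  qed
  show "c \<odot>\<^bsub>cot_space\<^esub> C \<in> ?S" if C: "C \<in> ?S" for c C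
  proof -
    obtain x where x: "x \<in> \<mm>" "C = coset x" using rep C by metis
    have xc: "x \<in> carrier A" using x max_ideal_carrier by auto
    have "\<rho> (t, 1) (c \<odot> x) \<ominus> \<chi> t \<odot> (c \<odot> x) \<in> \<mm>2" if t: "t \<in> carrier T" for t
    proof -
      have "c \<odot> (\<rho> (t, 1) x \<ominus> \<chi> t \<odot> x) \<in> \<mm>2"
        using C iff x t by (intro csubspaceD(5)[OF csubspace_max_sq]) auto
      then show ?thesis using xc g[OF t] by (simp add: smult_diff act_smult smult_smult mult.commute)
    qed
    then show ?thesis
      using iff[of "c \<odot> x"] csubspaceD(5)[OF csubspace_max_ideal] x xc by (simp add: cot.smult_Q)
  qed
qed

lemma csubspace_nontriv: "cot.Q.csubspace nontriv"
  unfolding nontrivial_part_def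
  by (rule cot.Q.csubspace_subspace_sum) (rule csubspace_T_weight_space)

lemma coset_wt_nontriv:
  assumes \<chi>: "\<chi> \<in> characters T" "\<chi> \<noteq> trivial_char T" and a: "a \<in> wt (\<chi>, k)" "a \<in> \<mm>"
  shows "coset a \<in> nontriv"
  unfolding nontrivial_part_def
proof (rule cot.Q.subspace_sum_mem[of \<chi>])
  show c: "coset a \<in> carrier cot_space" using a by (simp add: cot.carrier_Q)
  have "\<rho> (t, 1) a \<ominus> \<chi> t \<odot> a \<in> \<mm>2" if "t \<in> carrier T" for t
    using that a csubspaceD(3)[OF csubspace_max_sq]
    by (simp add: weight_space_def carrier_with_rot char_plus_def a_minus_def r_neg)
  then show "coset a \<in> weight_space T cot_space (T_action (induced_action \<rho>)) \<chi>"
    using c a by (auto simp: weight_space_def T_action_def coset_weight_iff carrier_with_rot)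
qed (use \<chi> in auto)

text \<open>The classes having such a representative form a subspace, so a single nontrivial
  T-weight \<open>\<chi>\<close> suffices. Some \<open>t\<close> has
  \<open>\<chi> t \<noteq> 1\<close>, whereas components with trivial T-weight have eigenvalue 1
  under \<open>(t, 1)\<close>; comparing eigenvalues modulo the square puts them there.\<close>

lemma nontriv_lift:
  assumes "C \<in> nontriv"
  obtains y where "y \<in> \<mm>" "C = coset y" "\<And>k. component (trivial_char T, k) y \<in> \<mm>2"
proof -
  let ?U = "coset ` {y \<in> \<mm>. \<forall>k. component (trivial_char T, k) y \<in> \<mm>2}"
  have "nontriv \<subseteq> ?U"
    unfolding nontrivial_part_def
  proof (rule cot.Q.subspace_sum_least)
    show "cot.Q.csubspace ?U"
    proof (rule cot.Q.csubspaceI)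
      show "?U \<subseteq> carrier cot_space" by (auto simp: cot.carrier_Q)
      show "\<zero>\<^bsub>cot_space\<^esub> \<in> ?U"
        unfolding cot.zero_Q_coset
        using csubspaceD(3)[OF csubspace_max_ideal] csubspaceD(3)[OF csubspace_max_sq] by auto
      show "C \<oplus>\<^bsub>cot_space\<^esub> D \<in> ?U" if CD: "C \<in> ?U" "D \<in> ?U" for C D
      proof -
        obtain x y where xy: "x \<in> \<mm>" "C = coset x" "\<And>k. component (trivial_char T, k) x \<in> \<mm>2"
          "y \<in> \<mm>" "D = coset y" "\<And>k. component (trivial_char T, k) y \<in> \<mm>2"
          using CD by auto
        then have "C \<oplus>\<^bsub>cot_space\<^esub> D = coset (x \<oplus> y)"
          using max_ideal_carrier by (simp add: cot.add_Q)
        then show ?thesis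
          using xy max_ideal_carrier csubspaceD(4)[OF csubspace_max_ideal] csubspaceD(4)[OF csubspace_max_sq]
          by (auto simp: component_add)
      qed
      show "c \<odot>\<^bsub>cot_space\<^esub> C \<in> ?U" if C: "C \<in> ?U" for c C
      proof -
        obtain x where x: "x \<in> \<mm>" "C = coset x" "\<And>k. component (trivial_char T, k) x \<in> \<mm>2"
          using C by auto
        then have "c \<odot>\<^bsub>cot_space\<^esub> C = coset (c \<odot> x)"
          using max_ideal_carrier by (simp add: cot.smult_Q)
        then show ?thesis
          using x max_ideal_carrier csubspaceD(5)[OF csubspace_max_ideal] csubspaceD(5)[OF csubspace_max_sq]
          by (auto simp: component_smult)
      qed
    qed
  next
    fix \<chi> assume "\<chi> \<in> characters T - {trivial_char T}"
    then obtain t where t: "t \<in> carrier T" "\<chi> t \<noteq> 1" using trivial_char_iff[OF torus] by auto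
    then have g: "(t, 1) \<in> carrier (with_rot T)" by (simp add: carrier_with_rot)
    show "weight_space T cot_space (T_action (induced_action \<rho>)) \<chi> \<subseteq> ?U"
    proof
      fix C assume C: "C \<in> weight_space T cot_space (T_action (induced_action \<rho>)) \<chi>"
      then obtain y where y: "y \<in> \<mm>" "C = coset y" by (auto simp: weight_space_def cot.carrier_Q)
      then have "induced_action \<rho> (t, 1) (coset y) = \<chi> t \<odot>\<^bsub>cot_space\<^esub> (coset y)"
        using C t by (simp add: weight_space_def T_action_def)
      then have "\<rho> (t, 1) y \<ominus> \<chi> t \<odot> y \<in> \<mm>2"
        using coset_weight_iff[OF g y(1)] by blast
      then have "component (trivial_char T, k) y \<in> \<mm>2" for k
        using t by (intro component_mem_of_weight_mod[OF max_ideal_carrier[OF y(1)] csubspace_max_sq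
              component_max_sq g]) (auto simp: char_plus_def trivial_char_def)
      then show "C \<in> ?U" using y by auto
    qed
  qed
  then show thesis using assms that by auto
qed

text \<open>Any other weight is separated from the prescribed one by a group element, so the other
  components of \<open>y\<close> lie in the square. The degree \<open>j\<close> may be negative: the
  component is then zero, and so is the class.\<close>

lemma coset_component_eq:
  assumes y: "y \<in> \<mm>" and \<chi>: "\<chi> \<in> characters T"
    and wt: "coset y \<in> weight_space (with_rot T) cot_space (induced_action \<rho>) (char_plus \<chi> j)"
  shows "coset (component (\<chi>, j) y) = coset y"
proof -
  have yc: "y \<in> carrier A" using y max_ideal_carrier by blast
  have "y \<ominus> component (\<chi>, j) y \<in> \<mm>2"
  proof (rule diff_component_mem[OF yc csubspace_max_sq])
    fix w assume w: "w \<in> weights" "w \<noteq> (\<chi>, j)"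
    obtain \<psi> k where [simp]: "w = (\<psi>, k)" by (cases w)
    obtain g where g: "g \<in> carrier (with_rot T)" "char_plus \<psi> k g \<noteq> char_plus \<chi> j g"
      using weights_separated[of \<psi> \<chi> k j] w \<chi> by auto
    have "\<rho> g y \<ominus> char_plus \<chi> j g \<odot> y \<in> \<mm>2"
      using coset_weight_iff[OF g(1) y, of "char_plus \<chi> j g"] wt g(1) unfolding weight_space_def by blast
    then show "component w y \<in> \<mm>2"
      using g by (intro component_mem_of_weight_mod[OF yc csubspace_max_sq component_max_sq g(1)]) auto
  qed
  then show ?thesis using yc cot.coset_eq_iff[of y "component (\<chi>, j) y"] by simp
qed

text \<open>The prescribed characters are not assumed nontrivial; this is forced. Otherwise the
  class also has a representative whose components of trivial T-weight lie in the square, and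
  comparing the two at weight \<open>(\<chi>, j)\<close> puts \<open>x\<close> into the
  square.\<close>

lemma nontriv_weight:
  assumes x: "x \<in> \<mm>" "coset x \<in> nontriv" "x \<notin> \<mm>2" "component (\<chi>, j) x = x"
  shows "\<chi> \<noteq> trivial_char T"
proof
  assume [simp]: "\<chi> = trivial_char T"
  obtain y where y: "y \<in> \<mm>" "coset x = coset y" "\<And>k. component (trivial_char T, k) y \<in> \<mm>2"
    using nontriv_lift[OF x(2)] by blast
  have c: "x \<in> carrier A" "y \<in> carrier A" using x y max_ideal_carrier by auto
  then have "x \<ominus> y \<in> \<mm>2" using y(2) by (simp add: cot.coset_eq_iff)
  then have "component (\<chi>, j) (x \<ominus> y) \<in> \<mm>2" by (rule component_max_sq)
  then have "x \<ominus> component (\<chi>, j) y \<in> \<mm>2" using x(4) c by (simp add: component_diff)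
  then have "x \<in> \<mm>2" by (rule csubspace_diff_cancel[OF csubspace_max_sq]) (use y c in auto)
  with x(3) show False by simp
qed

section \<open>Linear spans modulo the square of the maximal ideal\<close>

definition span_mod_sq :: "('i \<Rightarrow> 'a) \<Rightarrow> 'i set \<Rightarrow> 'a set" where
  "span_mod_sq x I = {y \<in> \<mm>. \<exists>c. y \<ominus> lincomb c x I \<in> \<mm>2}"

lemma span_mod_sqI: "y \<in> \<mm> \<Longrightarrow> y \<ominus> lincomb c x I \<in> \<mm>2 \<Longrightarrow> y \<in> span_mod_sq x I"
  by (auto simp: span_mod_sq_def)

lemma span_mod_sq_iff_coset:
  assumes "x \<in> I \<rightarrow> \<mm>" "y \<in> \<mm>"
  shows "y \<in> span_mod_sq x I \<longleftrightarrow> (\<exists>c. coset y = cot.Q.lincomb c (\<lambda>i. coset (x i)) I)"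
proof -
  have "lincomb c x I \<in> carrier A" for c
    using assms(1) max_ideal_carrier by (intro lincomb_closed) auto
  then show ?thesis
    using assms max_ideal_carrier[OF assms(2)]
    by (simp add: span_mod_sq_def cot.coset_lincomb cot.coset_eq_iff)
qed

lemma csubspace_span_mod_sq:
  assumes x: "x \<in> I \<rightarrow> \<mm>"
  shows "csubspace (span_mod_sq x I)"
proof (rule csubspaceI)
  have xc: "x \<in> I \<rightarrow> carrier A" using x max_ideal_carrier by auto
  have lc: "lincomb c x I \<in> carrier A" for c by (rule lincomb_closed[OF xc])
  show "span_mod_sq x I \<subseteq> carrier A" using max_ideal_carrier by (auto simp: span_mod_sq_def)
  have "\<zero> \<ominus> lincomb (\<lambda>_. 0) x I = \<zero>" using lincomb_zero[OF xc, of "\<lambda>_. 0"] by (simp add: a_minus_def)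
  then have "\<zero> \<ominus> lincomb (\<lambda>_. 0) x I \<in> \<mm>2" using csubspaceD(3)[OF csubspace_max_sq] by simp
  then show "\<zero> \<in> span_mod_sq x I"
    by (rule span_mod_sqI[OF csubspaceD(3)[OF csubspace_max_ideal]])
  show "y \<oplus> z \<in> span_mod_sq x I" if yz: "y \<in> span_mod_sq x I" "z \<in> span_mod_sq x I" for y z
  proof -
    obtain c d where cd: "y \<in> \<mm>" "z \<in> \<mm>" "y \<ominus> lincomb c x I \<in> \<mm>2" "z \<ominus> lincomb d x I \<in> \<mm>2"
      using yz by (auto simp: span_mod_sq_def)
    have "(y \<ominus> lincomb c x I) \<oplus> (z \<ominus> lincomb d x I) \<in> \<mm>2"
      using cd(3,4) by (rule csubspaceD(4)[OF csubspace_max_sq])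
    then have "(y \<oplus> z) \<ominus> lincomb (\<lambda>i. c i + d i) x I \<in> \<mm>2"
      using cd(1,2)[THEN max_ideal_carrier] lc lincomb_add[OF xc] by (simp add: diff_add_diff)
    then show ?thesis
      by (rule span_mod_sqI[OF csubspaceD(4)[OF csubspace_max_ideal cd(1,2)]])
  qed
  show "c \<odot> y \<in> span_mod_sq x I" if y: "y \<in> span_mod_sq x I" for c y
  proof -
    obtain d where d: "y \<in> \<mm>" "y \<ominus> lincomb d x I \<in> \<mm>2" using y by (auto simp: span_mod_sq_def)
    have "c \<odot> (y \<ominus> lincomb d x I) \<in> \<mm>2" using d(2) by (rule csubspaceD(5)[OF csubspace_max_sq])
    then have "c \<odot> y \<ominus> lincomb (\<lambda>i. c * d i) x I \<in> \<mm>2"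
      using d(1)[THEN max_ideal_carrier] lc lincomb_scale[OF xc] by (simp add: smult_diff)
    then show ?thesis
      by (rule span_mod_sqI[OF csubspaceD(5)[OF csubspace_max_ideal d(1)]])
  qed
qed

lemma max_sq_span_mod_sq:
  assumes x: "x \<in> I \<rightarrow> \<mm>"
  shows "\<mm>2 \<subseteq> span_mod_sq x I"
proof
  fix y assume y: "y \<in> \<mm>2"
  have xc: "x \<in> I \<rightarrow> carrier A" using x max_ideal_carrier by auto
  have "y \<ominus> lincomb (\<lambda>_. 0) x I = y"
    using lincomb_zero[OF xc, of "\<lambda>_. 0"] max_sq_carrier[OF y] by (simp add: a_minus_def)
  then have "y \<ominus> lincomb (\<lambda>_. 0) x I \<in> \<mm>2" using y by simp
  then show "y \<in> span_mod_sq x I" using y max_sq_subset by (intro span_mod_sqI) auto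
qed

lemma generator_span_mod_sq:
  assumes x: "x \<in> I \<rightarrow> \<mm>" "finite I" "p \<in> I"
  shows "x p \<in> span_mod_sq x I"
proof -
  have xc: "x \<in> I \<rightarrow> carrier A" using x max_ideal_carrier by auto
  have "x p \<ominus> lincomb (\<lambda>i. if i = p then 1 else 0) x I = \<zero>"
    using lincomb_single[OF xc x(2,3)] funcset_mem[OF xc x(3)] by (simp add: a_minus_def r_neg)
  then have "x p \<ominus> lincomb (\<lambda>i. if i = p then 1 else 0) x I \<in> \<mm>2"
    using csubspaceD(3)[OF csubspace_max_sq] by simp
  then show ?thesis by (rule span_mod_sqI[OF funcset_mem[OF x(1,3)]])
qed

text \<open>\<open>span_mod_sq\<close> is the preimage in the maximal ideal of the span of the
  classes. Keeping it inside the algebra allows it to be an ideal: for a suitable constant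
  \<open>c\<close>, the product \<open>a \<otimes> y\<close> differs from \<open>c \<odot> y\<close>
  by a product of two elements of the maximal ideal.\<close>

lemma Idl_subset_span_mod_sq:
  assumes x: "x \<in> I \<rightarrow> \<mm>" "finite I"
  shows "Idl (x ` I) \<subseteq> span_mod_sq x I"
proof (rule genideal_minimal)
  show "ideal (span_mod_sq x I) A"
  proof (rule csubspace_ideal[OF csubspace_span_mod_sq[OF x(1)]])
    fix a y assume a: "a \<in> carrier A" and y: "y \<in> span_mod_sq x I"
    then have ym: "y \<in> \<mm>" and yc: "y \<in> carrier A" using max_ideal_carrier by (auto simp: span_mod_sq_def)
    obtain c where c: "a \<ominus> c \<odot> \<one> \<in> \<mm>" using constant_plus_max_ideal[OF a] by blast
    have "(a \<ominus> c \<odot> \<one>) \<otimes> y \<in> span_mod_sq x I"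
      using mult_max_sq[OF c ym] max_sq_span_mod_sq[OF x(1)] by blast
    moreover have "(a \<ominus> c \<odot> \<one>) \<otimes> y = a \<otimes> y \<ominus> c \<odot> y"
      using a yc by (simp add: a_minus_def l_distr l_minus smult_mult_left)
    moreover have "c \<odot> y \<in> span_mod_sq x I"
      using y by (rule csubspaceD(5)[OF csubspace_span_mod_sq[OF x(1)]])
    ultimately show "a \<otimes> y \<in> span_mod_sq x I"
      using a yc by (intro csubspace_diff_cancel[OF csubspace_span_mod_sq[OF x(1)], of "a \<otimes> y" "c \<odot> y"]) auto
  qed
  show "x ` I \<subseteq> span_mod_sq x I" using generator_span_mod_sq[OF x] by blast
qed

section \<open>The fixed ideal and its generation by lifts\<close>

abbreviation "\<I> \<equiv> fixed_ideal T A \<rho>"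

lemma T_weight_vectors_carrier:
  "(\<Union>\<chi>\<in>characters T - {trivial_char T}. weight_space T A (T_action \<rho>) \<chi>) \<subseteq> carrier A"
  by (auto simp: weight_space_def)

lemma ideal_fixed_ideal: "ideal \<I> A"
  unfolding fixed_ideal_def by (rule genideal_ideal[OF T_weight_vectors_carrier])

lemma wt_fixed_ideal:
  assumes "\<chi> \<in> characters T" "\<chi> \<noteq> trivial_char T" "a \<in> wt (\<chi>, k)"
  shows "a \<in> \<I>"
proof -
  have "a \<in> weight_space T A (T_action \<rho>) \<chi>"
    using assms(3) by (auto simp: weight_space_def T_action_def carrier_with_rot char_plus_def)
  then show ?thesis
    using genideal_self[OF T_weight_vectors_carrier] assms unfolding fixed_ideal_def by blast
qed

text \<open>The defining generators are weight vectors for T alone and may mix degrees. Their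
  components have the same T-weight or vanish, and vanish in degree zero, so weight vectors of
  positive degree for the full torus suffice. This makes induction on the degree possible.\<close>

lemma fixed_ideal_least:
  assumes J: "ideal J A"
    and wt: "\<And>\<chi> k a. \<chi> \<in> characters T \<Longrightarrow> \<chi> \<noteq> trivial_char T \<Longrightarrow> k > 0 \<Longrightarrow> a \<in> wt (\<chi>, k) \<Longrightarrow> a \<in> J"
  shows "\<I> \<subseteq> J"
  unfolding fixed_ideal_def
proof (rule genideal_minimal[OF J], rule subsetI)
  fix a
  assume "a \<in> (\<Union>\<chi>\<in>characters T - {trivial_char T}. weight_space T A (T_action \<rho>) \<chi>)"
  then obtain \<chi> where \<chi>: "\<chi> \<in> characters T" "\<chi> \<noteq> trivial_char T"
    and a: "a \<in> weight_space T A (T_action \<rho>) \<chi>" by auto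
  note sub = ideal_csubspace[OF J]
  have ac: "a \<in> carrier A" using a by (simp add: weight_space_def)
  then show "a \<in> J"
  proof (rule homogeneous_induct)
    fix w assume w: "w \<in> weights"
    obtain \<psi> k where [simp]: "w = (\<psi>, k)" by (cases w)
    show "component w a \<in> J"
    proof (cases "\<psi> = \<chi>")
      case True
      then have "component w a \<in> wt (\<chi>, k)" using component_wt[OF ac, of w] by simp
      then show ?thesis
        using wt_degree_zero[OF _ \<chi>, of "component w a"] wt[OF \<chi>, of k "component w a"] w csubspaceD(3)[OF sub]
        by (cases "k = 0") auto
    next
      case False
      then obtain t where t: "t \<in> carrier T" "\<psi> t \<noteq> \<chi> t"
        using torus_character_ext[OF torus, of \<psi> \<chi>] \<chi> w by auto
      then have g: "(t, 1) \<in> carrier (with_rot T)" by (simp add: carrier_with_rot)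
      have "\<rho> (t, 1) a = \<chi> t \<odot> a" using a t(1) by (simp add: weight_space_def T_action_def)
      \<comment> \<open>The eigenvalue comparison with the zero subspace: \<open>a\<close> is an
        exact eigenvector of \<open>(t, 1)\<close>.\<close>
      then have "component w a \<in> {\<zero>}"
        using t ac
        by (intro component_mem_of_weight_mod[OF ac _ _ g, of "{\<zero>}" w "\<chi> t"] csubspaceI)
          (auto simp: a_minus_def r_neg char_plus_T)
      then show ?thesis using csubspaceD(3)[OF sub] by simp
    qed
  qed (use csubspaceD(3,4)[OF sub] in auto)
qed

lemma fixed_ideal_subset_max_ideal: "\<I> \<subseteq> \<mm>"
  by (rule fixed_ideal_least[OF ideal_max_ideal]) (rule wt_max_ideal)

text \<open>The combination approximating a weight vector modulo the square need not be homogeneous,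
  so both the error and the combination are projected to the weight at hand before the induction
  hypothesis is used.\<close>

lemma generators_of_fixed_ideal:
  assumes I: "finite I"
    and x: "\<And>i. i \<in> I \<Longrightarrow> x i \<in> \<mm> \<and> x i \<in> wt (\<chi> i, j i) \<and> \<chi> i \<in> characters T \<and> \<chi> i \<noteq> trivial_char T"
    and span: "\<And>\<psi> k a. \<psi> \<in> characters T \<Longrightarrow> \<psi> \<noteq> trivial_char T \<Longrightarrow> k > 0 \<Longrightarrow> a \<in> wt (\<psi>, k) \<Longrightarrow>
      a \<in> span_mod_sq x I"
  shows "Idl (x ` I) = \<I>"
proof
  let ?J = "Idl (x ` I)"
  have xm: "x \<in> I \<rightarrow> \<mm>" using x by auto
  have xc: "x \<in> I \<rightarrow> carrier A" using x max_ideal_carrier by auto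
  have J: "ideal ?J A" using xc by (intro genideal_ideal) auto
  have xJ: "x i \<in> ?J" if "i \<in> I" for i using genideal_self[of "x ` I"] xc that by auto
  note sub = ideal_csubspace[OF J]
  show "?J \<subseteq> \<I>"
  proof (rule genideal_minimal[OF ideal_fixed_ideal], rule image_subsetI)
    show "x i \<in> \<I>" if "i \<in> I" for i using x[OF that] wt_fixed_ideal[of "\<chi> i" "x i" "j i"] by simp
  qed
  have "wt (\<psi>, int k) \<subseteq> ?J" if "\<psi> \<in> characters T" "\<psi> \<noteq> trivial_char T" "k > 0" for \<psi> k
    using that
  proof (induction k arbitrary: \<psi> rule: less_induct)
    case (less k)
    show ?case
    proof
      fix a assume a: "a \<in> wt (\<psi>, int k)"
      have ac: "a \<in> carrier A" by (rule wt_carrier[OF a])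
      have w: "(\<psi>, int k) \<in> weights" using less.prems by simp
      obtain c where c: "a \<ominus> lincomb c x I \<in> \<mm>2"
        using span[OF less.prems(1,2) _ a] less.prems(3) by (auto simp: span_mod_sq_def)
      have lc: "lincomb c x I \<in> carrier A" using xc by (rule lincomb_closed)
      have "component (\<psi>, int k) (a \<ominus> lincomb c x I) \<in> ?J"
      proof (rule component_max_sq_mem[OF c _ _ sub])
        fix \<chi>1 k1 \<chi>2 k2 b d
        assume *: "\<chi>1 \<in> characters T" "\<chi>2 \<in> characters T" "k1 > 0" "k2 > 0" "int k = k1 + k2"
          "\<And>t. t \<in> carrier T \<Longrightarrow> \<psi> t = \<chi>1 t * \<chi>2 t" "b \<in> wt (\<chi>1, k1)" "d \<in> wt (\<chi>2, k2)"
        have bd: "b \<in> carrier A" "d \<in> carrier A" using wt_carrier[OF *(7)] wt_carrier[OF *(8)] .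
        \<comment> \<open>Two trivial T-weights would multiply to a trivial one, contrary to the
          choice of \<open>\<psi>\<close>.\<close>
        have "\<chi>1 \<noteq> trivial_char T \<or> \<chi>2 \<noteq> trivial_char T"
          using *(6) less.prems(1,2) *(1,2) trivial_char_iff[OF torus] by auto
        moreover have "nat k1 < k" "nat k2 < k" using *(3-5) by linarith+
        ultimately have "b \<in> ?J \<or> d \<in> ?J"
          using less.IH[of "nat k1" \<chi>1] less.IH[of "nat k2" \<chi>2] * by auto
        then show "b \<otimes> d \<in> ?J"
          using ideal.I_r_closed[OF J _ bd(2)] ideal.I_l_closed[OF J _ bd(1)] by (elim disjE)
      qed (use less.prems in auto)
      then have "a \<ominus> component (\<psi>, int k) (lincomb c x I) \<in> ?J"
        using component_of_wt[OF w a, of "(\<psi>, int k)"] ac lc by (simp add: component_diff)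
      \<comment> \<open>Projection leaves the generators of weight \<open>(\<psi>, int k)\<close>
        unchanged and kills all others.\<close>
      moreover have "component (\<psi>, int k) (lincomb c x I) \<in> ?J"
        unfolding component_lincomb[OF xc]
      proof (rule csubspace_lincomb[OF sub], rule Pi_I)
        fix i assume i: "i \<in> I"
        have wi: "x i \<in> wt (\<chi> i, j i)" using x[OF i] by blast
        show "component (\<psi>, int k) (x i) \<in> ?J"
        proof (cases "(\<chi> i, j i) = (\<psi>, int k)")
          case True
          then show ?thesis using component_of_wt[OF w, of "x i" "(\<psi>, int k)"] wi xJ[OF i] by simp
        next
          case False
          then obtain g where g: "g \<in> carrier (with_rot T)" "char_plus \<psi> (int k) g \<noteq> char_plus (\<chi> i) (j i) g"
            using weights_separated[of \<psi> "\<chi> i" "int k" "j i"] x[OF i] less.prems by auto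
          then have "component (\<psi>, int k) (x i) = \<zero>"
            using wi by (intro component_weight_vector[of _ "char_plus (\<chi> i) (j i)"]) auto
          then show ?thesis using csubspaceD(3)[OF sub] by simp
        qed
      qed
      ultimately show "a \<in> ?J" using ac by (rule csubspace_diff_cancel[OF sub])
    qed
  qed
  \<comment> \<open>The induction ran over natural numbers; positive integer degrees are covered by
    conversion.\<close>
  then have "a \<in> ?J" if "\<psi> \<in> characters T" "\<psi> \<noteq> trivial_char T" "k > 0" "a \<in> wt (\<psi>, k)" for \<psi> k a
    using that(4) zero_less_imp_eq_int[OF that(3)] that(1,2) by auto
  then show "\<I> \<subseteq> ?J" by (rule fixed_ideal_least[OF J])
qed

section \<open>Lower bound on the number of generators\<close>

lemma independent_card_le_generators:
  assumes I: "finite I" and x: "x \<in> I \<rightarrow> \<I>"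
    and indep: "\<And>c. cot.Q.lincomb c (\<lambda>i. coset (x i)) I = \<zero>\<^bsub>cot_space\<^esub> \<Longrightarrow> \<forall>i\<in>I. c i = 0"
    and S: "S \<subseteq> carrier A" "finite S" "Idl S = \<I>"
  shows "card I \<le> card S"
proof (rule cot.Q.independent_card_le[OF I S(2), of "\<lambda>s. coset s" "\<lambda>i. coset (x i)"])
  \<comment> \<open>Generators lie in the ideal they generate, and the fixed ideal lies in the
    maximal ideal, so the elements of \<open>S\<close> have cotangent classes.\<close>
  have "S \<subseteq> \<mm>" using genideal_self[OF S(1)] S(3) fixed_ideal_subset_max_ideal by blast
  then have Sm: "(\<lambda>s. s) \<in> S \<rightarrow> \<mm>" by auto
  then show "(\<lambda>s. coset s) \<in> S \<rightarrow> carrier cot_space" by (auto simp: cot.carrier_Q)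
  show "\<exists>a. coset (x i) = cot.Q.lincomb a (\<lambda>s. coset s) S" if "i \<in> I" for i
  proof -
    have "x i \<in> \<I>" using x that by blast
    then have "x i \<in> span_mod_sq (\<lambda>s. s) S" "x i \<in> \<mm>"
      using Idl_subset_span_mod_sq[OF Sm S(2)] S(3) fixed_ideal_subset_max_ideal by auto
    then show ?thesis using span_mod_sq_iff_coset[OF Sm] by blast
  qed
qed (rule indep)

text \<open>Finitely many elements generate the maximal ideal, and each has finitely many
  components. Those of nontrivial T-weight and positive degree span the nontrivial part.\<close>

lemma homogeneous_spanning_set:
  assumes noeth: "noetherian_ring A"
  obtains H where "finite H"
    "\<And>h. h \<in> H \<Longrightarrow> \<exists>\<chi> k. \<chi> \<in> characters T \<and> \<chi> \<noteq> trivial_char T \<and> k > 0 \<and> h \<in> wt (\<chi>, k)"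
    "nontriv = {cot.Q.lincomb c (\<lambda>h. coset h) H | c. True}"
proof -
  obtain S where S: "S \<subseteq> carrier A" "finite S" "\<mm> = Idl S"
    using noetherian_ring.finetely_gen[OF noeth ideal_max_ideal] by blast
  have "\<exists>J. finite J \<and> J \<subseteq> weights \<and> (\<forall>w. w \<notin> J \<longrightarrow> component w s = \<zero>)" if "s \<in> S" for s
  proof -
    have "s \<in> carrier A" using that S(1) by blast
    then show ?thesis
    proof (rule decomposition)
      fix J assume "finite J" "J \<subseteq> weights" "\<And>w. w \<notin> J \<Longrightarrow> component w s = \<zero>"
      then show ?thesis by (intro exI[of _ J]) simp
    qed
  qed
  then obtain J where J: "\<And>s. s \<in> S \<Longrightarrow> finite (J s)" "\<And>s. s \<in> S \<Longrightarrow> J s \<subseteq> weights"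
    "\<And>s w. s \<in> S \<Longrightarrow> w \<notin> J s \<Longrightarrow> component w s = \<zero>" by metis
  define H where "H = (\<Union>s\<in>S. (\<lambda>w. component w s) ` {w \<in> J s. fst w \<noteq> trivial_char T \<and> snd w > 0})"
  have fin: "finite H" unfolding H_def using S(2) J(1) by simp
  have Sm: "S \<subseteq> \<mm>" using genideal_self[OF S(1)] S(3) by blast
  have Hwt: "\<exists>\<chi> k. \<chi> \<in> characters T \<and> \<chi> \<noteq> trivial_char T \<and> k > 0 \<and> h \<in> wt (\<chi>, k)" if h: "h \<in> H" for h
  proof -
    obtain s \<chi> k where s: "s \<in> S" "(\<chi>, k) \<in> J s" "\<chi> \<noteq> trivial_char T" "k > 0" "h = component (\<chi>, k) s"
      using h unfolding H_def by auto
    then show ?thesis using component_wt[of s "(\<chi>, k)"] S(1) J(2)[of s] by auto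
  qed
  have "h \<in> \<mm>" if "h \<in> H" for h using Hwt[OF that] by (elim exE conjE) (rule wt_max_ideal)
  then have Hm: "(\<lambda>h. h) \<in> H \<rightarrow> \<mm>" by (rule Pi_I)
  let ?D = "span_mod_sq (\<lambda>h. h) H"
  have sub: "csubspace ?D" by (rule csubspace_span_mod_sq[OF Hm])
  \<comment> \<open>A component not collected in \<open>H\<close> is zero, either by lying outside
    the support of \<open>s\<close> or by having degree zero.\<close>
  have compD: "component (\<chi>, k) s \<in> ?D" if s: "s \<in> S" "(\<chi>, k) \<in> weights" "\<chi> \<noteq> trivial_char T" for s \<chi> k
  proof (cases "(\<chi>, k) \<in> J s \<and> k > 0")
    case True
    then have "(\<chi>, k) \<in> {w \<in> J s. fst w \<noteq> trivial_char T \<and> snd w > 0}" using s(3) by simp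
    then have "component (\<chi>, k) s \<in> H" unfolding H_def by (intro UN_I[OF s(1)] imageI)
    then show ?thesis by (rule generator_span_mod_sq[OF Hm fin])
  next
    case False
    then have "component (\<chi>, k) s = \<zero>"
      using J(3)[OF s(1), of "(\<chi>, k)"] s(2) subsetD[OF Sm s(1)] by (cases "k = 0") (auto simp: max_ideal_iff)
    then show ?thesis using csubspaceD(3)[OF sub] by simp
  qed
  have "\<exists>c. C = cot.Q.lincomb c (\<lambda>h. coset h) H" if C: "C \<in> nontriv" for C
  proof -
    obtain y where y: "y \<in> \<mm>" "C = coset y" "\<And>k. component (trivial_char T, k) y \<in> \<mm>2"
      using nontriv_lift[OF C] by blast
    have yc: "y \<in> carrier A" using y max_ideal_carrier by blast
    have Sid: "(\<lambda>s. s) \<in> S \<rightarrow> \<mm>" using Sm by auto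
    have Sc: "(\<lambda>s. s) \<in> S \<rightarrow> carrier A" using S(1) by auto
    obtain c where c: "y \<ominus> lincomb c (\<lambda>s. s) S \<in> \<mm>2"
      using Idl_subset_span_mod_sq[OF Sid S(2)] y(1) S(3) by (auto simp: span_mod_sq_def)
    have "y \<in> ?D" using yc
    proof (rule homogeneous_induct)
      fix w assume w: "w \<in> weights"
      obtain \<chi> k where [simp]: "w = (\<chi>, k)" by (cases w)
      show "component w y \<in> ?D"
      proof (cases "\<chi> = trivial_char T")
        case True
        then show ?thesis using y(3) max_sq_span_mod_sq[OF Hm] by auto
      next
        case False
        \<comment> \<open>At a nontrivial T-weight, \<open>y\<close> agrees modulo the square with a
          combination of components of the generators.\<close>
        have "component w (y \<ominus> lincomb c (\<lambda>s. s) S) \<in> ?D"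
          using component_max_sq[OF c] max_sq_span_mod_sq[OF Hm] by blast
        then have "component w y \<ominus> lincomb c (\<lambda>s. component w s) S \<in> ?D"
          using yc lincomb_closed[OF Sc] component_lincomb[OF Sc] by (simp add: component_diff)
        moreover have "lincomb c (\<lambda>s. component w s) S \<in> ?D"
          using compD[of _ \<chi> k] w False by (intro csubspace_lincomb[OF sub] Pi_I) simp
        ultimately show ?thesis
          by (rule csubspace_diff_cancel[OF sub _ _ component_closed[OF yc]])
      qed
    qed (use csubspaceD(3,4)[OF sub] in auto)
    then show ?thesis using span_mod_sq_iff_coset[OF Hm y(1)] y(2) by blast
  qed
  moreover have "cot.Q.lincomb c (\<lambda>h. coset h) H \<in> nontriv" for c
  proof (rule cot.Q.csubspace_lincomb[OF csubspace_nontriv], rule Pi_I)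
    fix h assume h: "h \<in> H"
    have "h \<in> \<mm>" using funcset_mem[OF Hm h] .
    with Hwt[OF h] show "coset h \<in> nontriv" by (elim exE conjE) (rule coset_wt_nontriv)
  qed
  ultimately have "nontriv = {cot.Q.lincomb c (\<lambda>h. coset h) H | c. True}" by blast
  then show thesis using that fin Hwt by blast
qed

text \<open>The lifting statement starts from a given basis. Existence of one is what the claims on
  dimension and number of generators require.\<close>

lemma homogeneous_basis_exists:
  assumes "noetherian_ring A"
  shows "\<exists>(n::nat) xbar \<chi> j. is_basis cot_space nontriv {1..n} xbar \<and>
    (\<forall>i\<in>{1..n}. \<chi> i \<in> characters T \<and>
      xbar i \<in> weight_space (with_rot T) cot_space (induced_action \<rho>) (char_plus (\<chi> i) (j i)))"
proof (rule homogeneous_spanning_set[OF assms])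
  fix H
  assume H: "finite H"
    "\<And>h. h \<in> H \<Longrightarrow> \<exists>\<chi> k. \<chi> \<in> characters T \<and> \<chi> \<noteq> trivial_char T \<and> k > 0 \<and> h \<in> wt (\<chi>, k)"
    "nontriv = {cot.Q.lincomb c (\<lambda>h. coset h) H | c. True}"
  have nc: "nontriv \<subseteq> carrier cot_space" using cot.Q.csubspaceD(1)[OF csubspace_nontriv] .
  have "(\<lambda>h. coset h) \<in> H \<rightarrow> nontriv" using H(2) coset_wt_nontriv wt_max_ideal by blast
  then obtain K where K: "K \<subseteq> H" "is_basis cot_space nontriv K (\<lambda>h. coset h)"
    using cot.Q.spanning_contains_basis[OF nc H(1) _ H(3)] by blast
  have "finite K" using K(1) H(1) finite_subset by blast
  then obtain f where f: "bij_betw f {1..card K} K" using ex_bij_betw_nat_finite_1 by blast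
  have basis: "is_basis cot_space nontriv {1..card K} ((\<lambda>h. coset h) \<circ> f)"
    by (rule cot.Q.is_basis_reindex[OF nc K(2) f]) simp
  have "\<forall>i\<in>{1..card K}. \<exists>\<chi> k. \<chi> \<in> characters T \<and> k > 0 \<and> f i \<in> wt (\<chi>, k)"
    using H(2) K(1) bij_betwE[OF f] by blast
  then obtain \<chi> k where \<chi>: "\<And>i. i \<in> {1..card K} \<Longrightarrow> \<chi> i \<in> characters T \<and> k i > 0 \<and> f i \<in> wt (\<chi> i, k i)"
    by metis
  have "((\<lambda>h. coset h) \<circ> f) i \<in> weight_space (with_rot T) cot_space (induced_action \<rho>) (char_plus (\<chi> i) (k i))"
    if i: "i \<in> {1..card K}" for i
  proof -
    have fi: "f i \<in> wt (\<chi> i, k i)" "f i \<in> \<mm>" using \<chi>[OF i] wt_max_ideal by auto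
    then show ?thesis
      using csubspaceD(3)[OF csubspace_max_sq]
      by (auto simp: weight_space_def cot.carrier_Q coset_weight_iff a_minus_def r_neg)
  qed
  then show ?thesis using basis \<chi> by blast
qed

lemma lift_homogeneous_basis:
  assumes basis: "is_basis cot_space nontriv {1..n::nat} xbar"
    and wt: "\<And>i. i \<in> {1..n} \<Longrightarrow> \<chi> i \<in> characters T \<and>
      xbar i \<in> weight_space (with_rot T) cot_space (induced_action \<rho>) (char_plus (\<chi> i) (j i))"
  obtains x where "\<And>i. i \<in> {1..n} \<Longrightarrow> x i \<in> wt (\<chi> i, j i) \<and> x i \<in> \<mm> \<and> coset (x i) = xbar i"
    "Idl (x ` {1..n}) = \<I>"
    "\<And>S. S \<subseteq> carrier A \<Longrightarrow> finite S \<Longrightarrow> Idl S = \<I> \<Longrightarrow> n \<le> card S"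
proof -
  let ?I = "{1..n}"
  have xbar: "xbar i \<in> nontriv" if "i \<in> ?I" for i using basis that unfolding is_basis_def by blast
  have indep: "\<forall>i\<in>?I. c i = 0" if "cot.Q.lincomb c xbar ?I = \<zero>\<^bsub>cot_space\<^esub>" for c
    using basis that unfolding is_basis_def by blast
  have nc: "nontriv \<subseteq> carrier cot_space" using cot.Q.csubspaceD(1)[OF csubspace_nontriv] .
  have "\<exists>y\<in>\<mm>. xbar i = coset y" if "i \<in> ?I" for i
    using subsetD[OF nc xbar[OF that]] by (auto simp: cot.carrier_Q)
  then obtain y where y: "\<And>i. i \<in> ?I \<Longrightarrow> y i \<in> \<mm> \<and> xbar i = coset (y i)" by metis
  define x where "x i = component (\<chi> i, j i) (y i)" for i
  have xwt: "x i \<in> wt (\<chi> i, j i)" if "i \<in> ?I" for i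
    unfolding x_def using y[OF that] max_ideal_carrier component_wt[of "y i" "(\<chi> i, j i)"] by simp
  have xm: "x i \<in> \<mm>" if "i \<in> ?I" for i
    unfolding x_def using y[OF that] component_max_ideal by blast
  have xc: "coset (x i) = xbar i" if "i \<in> ?I" for i
    unfolding x_def using coset_component_eq[of "y i" "\<chi> i" "j i"] y[OF that] wt[OF that] by simp
  have lin: "cot.Q.lincomb c (\<lambda>i. coset (x i)) ?I = cot.Q.lincomb c xbar ?I" for c
    using xc xbar nc by (intro cot.Q.lincomb_cong) auto
  have nt: "\<chi> i \<noteq> trivial_char T" if i: "i \<in> ?I" for i
  proof (rule nontriv_weight[OF xm[OF i]])
    show "coset (x i) \<in> nontriv" using xc xbar i by simp
    show "component (\<chi> i, j i) (x i) = x i"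
      unfolding x_def using y[OF i] max_ideal_carrier by (intro component_component) blast
    show "x i \<notin> \<mm>2"
    proof
      \<comment> \<open>A basis vector is nonzero: otherwise the coefficients that are 1 at
        \<open>i\<close> and 0 elsewhere would give a nontrivial relation.\<close>
      assume "x i \<in> \<mm>2"
      then have "xbar i = \<zero>\<^bsub>cot_space\<^esub>"
        using xc[OF i] cot.coset_eq_zero_iff[OF max_sq_carrier] by (simp add: cot.zero_Q)
      moreover have "xbar \<in> ?I \<rightarrow> carrier cot_space" using xbar nc by blast
      ultimately have "cot.Q.lincomb (\<lambda>l. if l = i then 1 else 0) xbar ?I = \<zero>\<^bsub>cot_space\<^esub>"
        using i by (simp add: cot.Q.lincomb_single)
      then show False using indep i by force
    qed
  qed
  have gen: "Idl (x ` ?I) = \<I>"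
  proof (rule generators_of_fixed_ideal)
    show "x i \<in> \<mm> \<and> x i \<in> wt (\<chi> i, j i) \<and> \<chi> i \<in> characters T \<and> \<chi> i \<noteq> trivial_char T" if "i \<in> ?I" for i
      using that xm xwt wt nt by blast
    fix \<psi> k a assume a: "\<psi> \<in> characters T" "\<psi> \<noteq> trivial_char T" "k > 0" "a \<in> wt (\<psi>, k)"
    then have am: "a \<in> \<mm>" using wt_max_ideal by blast
    then have "coset a \<in> nontriv" using coset_wt_nontriv a by blast
    then obtain c where "coset a = cot.Q.lincomb c xbar ?I" using basis unfolding is_basis_def by blast
    then show "a \<in> span_mod_sq x ?I"
      using span_mod_sq_iff_coset[of x ?I a] xm am lin by auto
  qed simp
  have xI: "x \<in> ?I \<rightarrow> \<I>" using xwt wt nt wt_fixed_ideal by blast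
  have "n \<le> card S" if "S \<subseteq> carrier A" "finite S" "Idl S = \<I>" for S
    using independent_card_le_generators[OF _ xI _ that] indep lin by simp
  then show thesis using that[of x] xwt xm xc gen by blast
qed

text \<open>Applied to the image itself, the lower bound forces the lifts to be pairwise distinct. A
  proper subset then has fewer than \<open>n\<close> elements and cannot generate.\<close>

lemma minimal_lift:
  assumes x: "x ` {1..n::nat} \<subseteq> carrier A" "Idl (x ` {1..n}) = \<I>"
    and le: "\<And>S. S \<subseteq> carrier A \<Longrightarrow> finite S \<Longrightarrow> Idl S = \<I> \<Longrightarrow> n \<le> card S"
  shows "minimal_generating_set A \<I> (x ` {1..n})" "min_num_generators A \<I> = n"
proof -
  have card: "card (x ` {1..n}) = n"
    using le[OF x(1) _ x(2)] card_image_le[of "{1..n}" x] by simp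
  show "minimal_generating_set A \<I> (x ` {1..n})"
    unfolding minimal_generating_set_def
  proof (intro conjI x allI impI)
    fix S assume S: "S \<subset> x ` {1..n}"
    then have "card S < n" using psubset_card_mono[of "x ` {1..n}" S] card by simp
    moreover have "finite S" "S \<subseteq> carrier A" using S x(1) finite_subset by auto
    ultimately show "Idl S \<noteq> \<I>" using le[of S] by fastforce
  qed
  show "min_num_generators A \<I> = n"
    unfolding min_num_generators_def
  proof (rule Least_equality)
    show "\<exists>S\<subseteq>carrier A. finite S \<and> card S = n \<and> Idl S = \<I>" using x card by blast
  qed (use le in blast)
qed

end

theorem proposition1p1:
  fixes T :: "'t affine_group"
    and A :: "(complex, 'a) module"
    and \<rho> :: "'t \<times> complex \<Rightarrow> 'a \<Rightarrow> 'a"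
  assumes torus: "algebraic_torus T"
    and alg: "algebra (ring_of_type_algebra :: complex ring) A"
    and noeth: "noetherian_ring A"
    and action: "algebraic_action (with_rot T) A \<rho>"
    and grading: "is_direct_sum A (characters T \<times> {k::int. k \<ge> 0})
                    (\<lambda>(\<chi>, k). weight_space (with_rot T) A \<rho> (char_plus \<chi> k))"
    and rot_invariants: "bij_betw (\<lambda>c. c \<odot>\<^bsub>A\<^esub> \<one>\<^bsub>A\<^esub>) UNIV
                    {a \<in> carrier A. \<forall>z\<in>carrier Gm. rot_action T \<rho> z a = a}"
  shows "(\<forall>(n::nat) xbar \<chi> j.
            is_basis (cotangent T A \<rho>)
              (nontrivial_part T (cotangent T A \<rho>) (induced_action \<rho>)) {1..n} xbar \<and>
            (\<forall>i\<in>{1..n}. \<chi> i \<in> characters T \<and>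
               xbar i \<in> weight_space (with_rot T) (cotangent T A \<rho>) (induced_action \<rho>)
                          (char_plus (\<chi> i) (j i)))
            \<longrightarrow>
            (\<exists>x. (\<forall>i\<in>{1..n}.
                    x i \<in> weight_space (with_rot T) A \<rho> (char_plus (\<chi> i) (j i)) \<and>
                    x i \<in> maximal_ideal_rot T A \<rho> \<and>
                    maximal_ideal_sq T A \<rho> +>\<^bsub>A\<^esub> x i = xbar i) \<and>
                 minimal_generating_set A (fixed_ideal T A \<rho>) (x ` {1..n}))) \<and>
         finite_dimensional (cotangent T A \<rho>)
           (nontrivial_part T (cotangent T A \<rho>) (induced_action \<rho>)) \<and>
         min_num_generators A (fixed_ideal T A \<rho>) =
           vdim (cotangent T A \<rho>)
             (nontrivial_part T (cotangent T A \<rho>) (induced_action \<rho>))"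
proof -
  interpret rot_graded_algebra T A \<rho>
    using torus alg action grading rot_invariants by (rule rot_graded_algebra.intro)
  have lift: "\<exists>x. (\<forall>i\<in>{1..n}. x i \<in> wt (\<chi> i, j i) \<and> x i \<in> \<mm> \<and> coset (x i) = xbar i) \<and>
      minimal_generating_set A \<I> (x ` {1..n}) \<and> min_num_generators A \<I> = n"
    if "is_basis cot_space nontriv {1..n} xbar"
      "\<And>i. i \<in> {1..n} \<Longrightarrow> \<chi> i \<in> characters T \<and>
        xbar i \<in> weight_space (with_rot T) cot_space (induced_action \<rho>) (char_plus (\<chi> i) (j i))"
    for n :: nat and xbar \<chi> j
  proof (rule lift_homogeneous_basis[OF that])
    fix x
    assume x: "\<And>i. i \<in> {1..n} \<Longrightarrow> x i \<in> wt (\<chi> i, j i) \<and> x i \<in> \<mm> \<and> coset (x i) = xbar i"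
      and gen: "Idl\<^bsub>A\<^esub> (x ` {1..n}) = \<I>"
      and le: "\<And>S. S \<subseteq> carrier A \<Longrightarrow> finite S \<Longrightarrow> Idl\<^bsub>A\<^esub> S = \<I> \<Longrightarrow> n \<le> card S"
    have xc: "x ` {1..n} \<subseteq> carrier A" using x max_ideal_carrier by blast
    show ?thesis using x minimal_lift[OF xc gen le] by blast
  qed
  \<comment> \<open>One concrete homogeneous basis links the two numbers: its length is the
    dimension, and by \<open>lift\<close> also the minimal number of generators.\<close>
  obtain n :: nat and xbar \<chi> j where "is_basis cot_space nontriv {1..n} xbar \<and>
    (\<forall>i\<in>{1..n}. \<chi> i \<in> characters T \<and>
      xbar i \<in> weight_space (with_rot T) cot_space (induced_action \<rho>) (char_plus (\<chi> i) (j i)))"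
    using homogeneous_basis_exists[OF noeth] by auto
  then have basis: "is_basis cot_space nontriv {1..n} xbar"
    "\<And>i. i \<in> {1..n} \<Longrightarrow> \<chi> i \<in> characters T \<and>
      xbar i \<in> weight_space (with_rot T) cot_space (induced_action \<rho>) (char_plus (\<chi> i) (j i))"
    by blast+
  have "min_num_generators A \<I> = n" using lift[OF basis] by blast
  moreover have "vdim cot_space nontriv = n"
    using cot.Q.vdim_eq[OF cot.Q.csubspaceD(1)[OF csubspace_nontriv] basis(1)] .
  moreover have "finite_dimensional cot_space nontriv"
    unfolding finite_dimensional_def using basis(1) by blast
  moreover note lift
  ultimately show ?thesis by fastforce
qed

end
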